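(* Let $d\ge2$, $\mathcal{C}>0$, $\beta\in(0,1/2)$, and let $X$ be a $p_n$-ERW in direction $\ell\in\mathbb{S}^{d-1}$ on $\mathbb{Z}^d$ with $p_n=\mathcal{C}n^{-\beta}\wedge1$. Assume that $$\liminf_{n\to\infty}\frac{|\mathcal{R}_n^X|}{n}\ge\pi_d\quad\text{almost surely.}$$ Then $$\lim_{n\to\infty}\frac{X_n}{n^{1-\beta}}=\mathcal{C}\,\frac{\pi_d\,\mathbb{E}[\gamma_1]}{1-\beta}\quad\text{almost surely.}$$
   Context: Definition of the $p_n$-ERW in direction $\ell$ on $\mathbb{Z}^d$. Let $d\ge 2$, let $\ell\in\mathbb{S}^{d-1}$ (the unit sphere of $\mathbb{R}^d$), let $\|\cdot\|$ be the Euclidean norm, and let $\{p_n\}_{n\ge1}\subset(0,1]$. Let $\{\xi_i\}_{i\ge1}$ and $\{\gamma_i\}_{i\ge1}$ be sequences of $\mathbb{Z}^d$-valued random vectors on a probability space $(\Omega,\mathcal{F},\mathbb{P})$, adapted to a filtration $\{\mathcal{F}_n\}_{n\ge0}$ (with $\mathcal{F}_0$ containing all null sets), such that: (i) there is a constant $K>0$ with $\sup_{n}\|\xi_n\|\le K$ and $\sup_n\|\gamma_n\|\le K$ on every realization; (ii) there is a constant $\lambda>0$ such that for all $n\ge1$, $\mathbb{E}[\xi_n\mid\mathcal{F}_{n-1}]=0$ and $\mathbb{E}[\gamma_n\cdot\ell\mid\mathcal{F}_{n-1}]\ge\lambda$; (iii) $\{\xi_i\}$ is i.i.d. with zero mean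 vector and finite covariance matrix, and $\mathbb{P}[\xi_i\cdot\ell'=0]<1$ for all $\ell'\in\mathbb{S}^{d-1}$; (iv) $\{\gamma_i\}$ is i.i.d., and the sequences $\{\xi_i\}$ and $\{\gamma_i\}$ are independent of each other. Let $\{U_i\}_{i\ge1}$ be i.i.d. uniform on $[0,1]$, independent of $(\{\xi_i\},\{\gamma_i\})$. Set $X_0=0$, $E_0=\emptyset$, and for $n\ge1$ let $E_n=\{\exists k<n:\ X_k=X_n\}$. The process $X=\{X_n\}_{n\ge0}$ is defined by $$X_n=\sum_{i=1}^n\Big(\mathbf{1}_{E_{i-1}}\xi_i+\mathbf{1}_{E_{i-1}^c\cap\{U_i>p_i\}}\xi_i+\mathbf{1}_{E_{i-1}^c\cap\{U_i\le p_i\}}\gamma_i\Big),\quad n\ge1.$$ The range is $\mathcal{R}_n^X=\{X_0,X_1,\dots,X_n\}\subset\mathbb{Z}^d$. The constant $\pi_d$ is the probability that the random walk $Y_n=\sum_{i=1}^n\xi_i$, $Y_0=0$, never returns to the origin. $a\wedge b=\min(a,b)$. *)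

theory Defs
  imports "HOL-Probability.Probability"
begin

definition int_lattice :: "(real ^ 'd::finite) set" where
  "int_lattice = {x. \<forall>j. x $ j \<in> \<int>}"

definition revisits :: "(nat \<Rightarrow> 'w \<Rightarrow> 'a) \<Rightarrow> nat \<Rightarrow> 'w \<Rightarrow> bool" where
  "revisits X n \<omega> \<longleftrightarrow> (\<exists>k<n. X k \<omega> = X n \<omega>)"

definition walk_range :: "(nat \<Rightarrow> 'w \<Rightarrow> 'a) \<Rightarrow> nat \<Rightarrow> 'w \<Rightarrow> 'a set" where
  "walk_range X n \<omega> = (\<lambda>k. X k \<omega>) ` {0..n}"

definition random_walk :: "(nat \<Rightarrow> 'w \<Rightarrow> 'a::comm_monoid_add) \<Rightarrow> nat \<Rightarrow> 'w \<Rightarrow> 'a" where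
  "random_walk \<xi> n \<omega> = (\<Sum>i = 1..n. \<xi> i \<omega>)"

definition escape_prob :: "'w measure \<Rightarrow> (nat \<Rightarrow> 'w \<Rightarrow> 'a::comm_monoid_add) \<Rightarrow> real" where
  "escape_prob M \<xi> = measure M {\<omega> \<in> space M. \<forall>n\<ge>1. random_walk \<xi> n \<omega> \<noteq> 0}"

definition (in prob_space) iid :: "(nat \<Rightarrow> 'a \<Rightarrow> 'b::topological_space) \<Rightarrow> bool" where
  "iid Z \<longleftrightarrow> indep_vars (\<lambda>_. borel) Z {1..} \<and>
    (\<forall>i\<ge>1. distr M borel (Z i) = distr M borel (Z 1))"

text \<open>
  \<open>indep_var\<close> forces both random variables to have the same value type; this is the
  same notion for two different value types.
\<close>

definition (in prob_space) indep_rv ::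
    "'b measure \<Rightarrow> ('a \<Rightarrow> 'b) \<Rightarrow> 'c measure \<Rightarrow> ('a \<Rightarrow> 'c) \<Rightarrow> bool" where
  "indep_rv S A T B \<longleftrightarrow> random_variable S A \<and> random_variable T B \<and>
    indep_set {A -` E \<inter> space M | E. E \<in> sets S} {B -` E \<inter> space M | E. E \<in> sets T}"

lemma (in prob_space) indep_var_iff_indep_rv: "indep_var S A T B \<longleftrightarrow> indep_rv S A T B"
proof -
  have *: "(\<lambda>i. {case_bool A B i -` E \<inter> space M | E. E \<in> sets (case_bool S T i)}) =
      case_bool {A -` E \<inter> space M | E. E \<in> sets S} {B -` E \<inter> space M | E. E \<in> sets T}"
    by (auto simp: fun_eq_iff split: bool.split)
  show ?thesis
    unfolding indep_var_def indep_vars_def2 indep_rv_def indep_set_def *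
    by (auto simp: UNIV_bool)
qed

abbreviation seq_space :: "(nat \<Rightarrow> 'b::topological_space) measure" where
  "seq_space \<equiv> \<Pi>\<^sub>M i\<in>{1..}. borel"

abbreviation as_seq :: "(nat \<Rightarrow> 'w \<Rightarrow> 'b) \<Rightarrow> 'w \<Rightarrow> nat \<Rightarrow> 'b" where
  "as_seq Z \<omega> \<equiv> (\<lambda>i\<in>{1..}. Z i \<omega>)"

text \<open>
  The sequences \<open>\<xi>\<close>, \<open>\<gamma>\<close>, \<open>U\<close> and \<open>p\<close> are indexed from 1; their values at index 0 are
  unconstrained and never used. Vector-valued conditional expectations are taken
  componentwise. The excited set at time 0 is empty, since no \<open>k < 0\<close> exists, so
  \<open>revisits X 0 \<omega>\<close> is false.
\<close>

locale excited_random_walk = prob_space M + filtration "space M" F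
  for M :: "'w measure" and F :: "nat \<Rightarrow> 'w measure" +
  fixes \<xi> \<gamma> :: "nat \<Rightarrow> 'w \<Rightarrow> real ^ 'd::finite"
    and U :: "nat \<Rightarrow> 'w \<Rightarrow> real"
    and p :: "nat \<Rightarrow> real"
    and l :: "real ^ 'd"
    and X :: "nat \<Rightarrow> 'w \<Rightarrow> real ^ 'd"
  assumes dim: "CARD('d) \<ge> 2"
    and direction: "norm l = 1"
    and p_range: "\<And>n. n \<ge> 1 \<Longrightarrow> 0 < p n \<and> p n \<le> 1"
    and subalg: "\<And>n. subalgebra M (F n)"
    and F0_null_sets: "null_sets M \<subseteq> sets (F 0)"
    and xi_adapted: "\<And>n. n \<ge> 1 \<Longrightarrow> \<xi> n \<in> borel_measurable (F n)"
    and gamma_adapted: "\<And>n. n \<ge> 1 \<Longrightarrow> \<gamma> n \<in> borel_measurable (F n)"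
    and lattice_valued:
      "\<And>n \<omega>. n \<ge> 1 \<Longrightarrow> \<omega> \<in> space M \<Longrightarrow> \<xi> n \<omega> \<in> int_lattice \<and> \<gamma> n \<omega> \<in> int_lattice"
    and bounded_jumps:
      "\<exists>K>0. \<forall>n\<ge>1. \<forall>\<omega>\<in>space M. norm (\<xi> n \<omega>) \<le> K \<and> norm (\<gamma> n \<omega>) \<le> K"
    and xi_cond_exp:
      "\<And>n j. n \<ge> 1 \<Longrightarrow> AE \<omega> in M. real_cond_exp M (F (n - 1)) (\<lambda>\<omega>. \<xi> n \<omega> $ j) \<omega> = 0"
    and gamma_drift:
      "\<exists>c>0. \<forall>n\<ge>1. AE \<omega> in M. real_cond_exp M (F (n - 1)) (\<lambda>\<omega>. \<gamma> n \<omega> \<bullet> l) \<omega> \<ge> c"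
    and xi_iid: "iid \<xi>"
    and xi_mean: "\<And>i. i \<ge> 1 \<Longrightarrow> integrable M (\<xi> i) \<and> expectation (\<xi> i) = 0"
    and xi_covariance:
      "\<And>i j k. i \<ge> 1 \<Longrightarrow> integrable M (\<lambda>\<omega>. \<xi> i \<omega> $ j * \<xi> i \<omega> $ k)"
    and xi_nondegenerate:
      "\<And>i l'. i \<ge> 1 \<Longrightarrow> norm l' = 1 \<Longrightarrow> prob {\<omega> \<in> space M. \<xi> i \<omega> \<bullet> l' = 0} < 1"
    and gamma_iid: "iid \<gamma>"
    and xi_gamma_indep: "indep_var seq_space (as_seq \<xi>) seq_space (as_seq \<gamma>)"
    and U_iid: "iid U"
    and U_uniform: "\<And>i. i \<ge> 1 \<Longrightarrow> distr M borel (U i) = uniform_measure lborel {0..1}"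
    and U_indep:
      "indep_rv seq_space (as_seq U)
         (seq_space \<Otimes>\<^sub>M seq_space) (\<lambda>\<omega>. (as_seq \<xi> \<omega>, as_seq \<gamma> \<omega>))"
    and X_zero: "\<And>\<omega>. \<omega> \<in> space M \<Longrightarrow> X 0 \<omega> = 0"
    and X_eq: "\<And>n \<omega>. n \<ge> 1 \<Longrightarrow> \<omega> \<in> space M \<Longrightarrow>
      X n \<omega> = (\<Sum>i = 1..n.
          of_bool (revisits X (i - 1) \<omega>) *\<^sub>R \<xi> i \<omega>
        + of_bool (\<not> revisits X (i - 1) \<omega> \<and> U i \<omega> > p i) *\<^sub>R \<xi> i \<omega>
        + of_bool (\<not> revisits X (i - 1) \<omega> \<and> U i \<omega> \<le> p i) *\<^sub>R \<gamma> i \<omega>)"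

end

theory Submission
  imports Defs "HOL-Real_Asymp.Real_Asymp"
begin

text \<open>
  Call a time \<open>i\<close> fresh if \<open>X i\<close> is a site not visited before, and let the coin of time \<open>i + 1\<close> show
  heads if \<open>U (i + 1) \<le> p (i + 1)\<close>. The walk takes the step \<open>\<xi> (i + 1)\<close> except when \<open>i\<close> is fresh and the
  coin shows heads; then the cookie \<open>\<gamma> (i + 1)\<close> replaces it. Subtracting from each replacement its mean given
  the past splits each coordinate of \<open>X n\<close>
  (\<open>X_decomposition\<close>) into
  \<^item> the centred random walk formed by all the steps,
  \<^item> a martingale built from the centred cookie corrections, and
  \<^item> the drift \<open>E \<gamma>\<close> times the sum of \<open>p (i + 1)\<close> over the fresh times \<open>i < n\<close>.

  Whether \<open>i\<close> is fresh is determined by the past, and the past is independent of the triple of time \<open>i + 1\<close>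
  (\<open>indep_info\<close>, \<open>X_info\<close>). So the first two are transforms \<open>\<Sum>i<n. H i * V i\<close> of bounded centred variables \<open>V i\<close> by predictable
  \<open>H i \<in> {0, 1}\<close>. Hoeffding's lemma gives them Gaussian tails, so they are \<open>o(n\<^sup>\<alpha>)\<close> almost surely for every
  \<open>\<alpha> > 1/2\<close> (\<open>transform_over_powr_tendsto_0\<close>). This is where \<open>\<beta> < 1/2\<close> enters: \<open>\<alpha> = 1 - \<beta>\<close> qualifies.

  For the drift, the number of fresh times is the size of the range. By hypothesis its lower density is at
  least the escape probability; the matching upper bound holds for every walk of this kind whose excitation
  probabilities vanish (\<open>range_density_upper\<close>). Indeed each site of the range has a last visit. If the last
  visit up to time \<open>n\<close> is at time \<open>k \<le> n - m\<close>, then either one of the coins \<open>k + 1, \<dots>, k + m\<close> shows heads,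
  which concerns a vanishing fraction of the times, or the walk driven by \<open>\<xi>\<close> alone does not come back within
  \<open>m\<close> steps after time \<open>k\<close>. The frequency of the latter event is its probability, by the law of large numbers
  along each residue class modulo \<open>m\<close>, and this probability decreases to the escape probability as \<open>m\<close>
  grows. So the fresh times have a density, and summation by parts against the decreasing weights
  \<open>p (i + 1)\<close> turns that density into the claimed constant (\<open>weighted_sum_asymp\<close>, \<open>sum_cut_powr_asymp\<close>).
\<close>

section \<open>Averages and weighted sums of sequences\<close>

text \<open>
  The differences \<open>c i - L * d i\<close> are small relative to \<open>d i\<close> from some index on, and the finitely many
  earlier ones are swallowed by the diverging denominator.
\<close>
lemma stolz_cesaro:
  fixes c d :: "nat \<Rightarrow> real"
  assumes pos: "\<And>i. d i > 0"
    and div: "filterlim (\<lambda>n. \<Sum>i<n. d i) at_top sequentially"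
    and lim: "(\<lambda>i. c i / d i) \<longlonglongrightarrow> L"
  shows "(\<lambda>n. (\<Sum>i<n. c i) / (\<Sum>i<n. d i)) \<longlonglongrightarrow> L"
proof (rule LIMSEQ_I)
  fix r :: real assume r: "r > 0"
  define D where "D n = (\<Sum>i<n. d i)" for n
  obtain N where N: "\<And>i. i \<ge> N \<Longrightarrow> \<bar>c i / d i - L\<bar> < r / 2"
    using LIMSEQ_D[OF lim, of "r / 2"] r by auto
  have N': "\<bar>c i - L * d i\<bar> \<le> r / 2 * d i" if "i \<ge> N" for i
  proof -
    have "\<bar>c i - L * d i\<bar> = \<bar>c i / d i - L\<bar> * d i"
    proof -
      have "c i - L * d i = (c i / d i - L) * d i" using pos[of i] by (simp add: field_simps)
      then show ?thesis using pos[of i] by (simp add: abs_mult)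
    qed
    then show ?thesis using N[OF that] pos[of i] by (auto intro: mult_right_mono less_imp_le)
  qed
  define K where "K = (\<Sum>i<N. \<bar>c i - L * d i\<bar>)"
  have bound: "\<bar>(\<Sum>i<n. c i) - L * D n\<bar> \<le> K + r / 2 * D n" for n
  proof -
    have "(\<Sum>i<n. c i) - L * D n = (\<Sum>i<n. c i - L * d i)"
      by (simp add: D_def sum_subtractf sum_distrib_left)
    also have "\<bar>\<dots>\<bar> \<le> (\<Sum>i<n. \<bar>c i - L * d i\<bar>)" by (rule sum_abs)
    also have "\<dots> \<le> (\<Sum>i<n. (if i < N then \<bar>c i - L * d i\<bar> else 0) + r / 2 * d i)"
    proof (rule sum_mono)
      fix i show "\<bar>c i - L * d i\<bar> \<le> (if i < N then \<bar>c i - L * d i\<bar> else 0) + r / 2 * d i"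
        using N'[of i] pos[of i] r by auto
    qed
    also have "\<dots> = (\<Sum>i<n. if i < N then \<bar>c i - L * d i\<bar> else 0) + r / 2 * D n"
      by (simp add: sum.distrib D_def sum_distrib_left)
    also have "(\<Sum>i<n. if i < N then \<bar>c i - L * d i\<bar> else 0) = (\<Sum>i\<in>{i \<in> {..<n}. i < N}. \<bar>c i - L * d i\<bar>)"
      by (rule sum.inter_filter[symmetric]) simp
    also have "\<dots> \<le> K"
      unfolding K_def by (rule sum_mono2) auto
    finally show ?thesis by simp
  qed
  have "eventually (\<lambda>n. D n > 2 * K / r + 1) sequentially"
    using div unfolding D_def filterlim_at_top_dense by auto
  then obtain N1 where N1: "\<And>n. n \<ge> N1 \<Longrightarrow> D n > 2 * K / r + 1"
    by (auto simp: eventually_sequentially)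
  have K: "K \<ge> 0" unfolding K_def by (intro sum_nonneg) auto
  show "\<exists>N. \<forall>n\<ge>N. norm ((\<Sum>i<n. c i) / (\<Sum>i<n. d i) - L) < r"
  proof (intro exI allI impI)
    fix n assume n: "n \<ge> N1"
    have "0 \<le> 2 * K / r" using K r by simp
    then have D: "D n > 0" using N1[OF n] by linarith
    have "K < r / 2 * D n" using N1[OF n] r by (simp add: field_simps)
    note D = D this
    have "\<bar>(\<Sum>i<n. c i) / D n - L\<bar> = \<bar>(\<Sum>i<n. c i) - L * D n\<bar> / D n"
    proof -
      have "(\<Sum>i<n. c i) / D n - L = ((\<Sum>i<n. c i) - L * D n) / D n" using D by (simp add: field_simps)
      then show ?thesis using D by (simp add: abs_divide)
    qed
    also have "\<dots> < r" using bound[of n] D by (simp add: field_simps)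
    finally show "norm ((\<Sum>i<n. c i) / (\<Sum>i<n. d i) - L) < r" by (simp add: D_def)
  qed
qed

text \<open>
  The weights are compared with the increments of \<open>n powr (1 - \<beta>)\<close>, which telescope.
\<close>
lemma sum_cut_powr_asymp:
  fixes C \<beta> :: real
  assumes "C > 0" "0 < \<beta>" "\<beta> < 1"
  shows "(\<lambda>n. (\<Sum>i<n. min (C * real (Suc i) powr (-\<beta>)) 1) / real n powr (1 - \<beta>)) \<longlonglongrightarrow> C / (1 - \<beta>)"
proof -
  define d where "d i = real (Suc i) powr (1 - \<beta>) - real i powr (1 - \<beta>)" for i :: nat
  have d: "(\<Sum>i<n. d i) = real n powr (1 - \<beta>)" for n
    unfolding d_def by (subst sum_lessThan_telescope[of "\<lambda>i. real i powr (1 - \<beta>)"]) simp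
  have "(\<lambda>n. (\<Sum>i<n. min (C * real (Suc i) powr (-\<beta>)) 1) / (\<Sum>i<n. d i)) \<longlonglongrightarrow> C / (1 - \<beta>)"
  proof (rule stolz_cesaro)
    show "d i > 0" for i using assms by (auto simp: d_def intro!: powr_less_mono2)
    show "filterlim (\<lambda>n. \<Sum>i<n. d i) at_top sequentially"
      unfolding d using assms by real_asymp
    have "(\<lambda>i. C * real (Suc i) powr (-\<beta>)) \<longlonglongrightarrow> 0"
      using assms by real_asymp
    then have "eventually (\<lambda>i. C * real (Suc i) powr (-\<beta>) < 1) sequentially"
      by (rule order_tendstoD) simp
    moreover have "(\<lambda>i. C * real (Suc i) powr (-\<beta>) / d i) \<longlonglongrightarrow> C / (1 - \<beta>)"
      unfolding d_def using assms by real_asymp (simp add: divide_inverse)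
    ultimately show "(\<lambda>i. min (C * real (Suc i) powr (-\<beta>)) 1 / d i) \<longlonglongrightarrow> C / (1 - \<beta>)"
      by (elim Lim_transform_eventually) (auto elim!: eventually_mono)
  qed
  then show ?thesis by (simp add: d)
qed

text \<open>
  Summation by parts. The sums of \<open>e i - \<epsilon>\<close> never exceed \<open>K\<close>, and against decreasing nonnegative weights
  they cannot contribute more than \<open>K\<close> times the largest weight.
\<close>
lemma abel_bound:
  fixes e b :: "nat \<Rightarrow> real"
  assumes "decseq b" and "\<And>n. b n \<ge> 0"
    and "\<And>n. (\<Sum>i<n. e i) \<le> \<epsilon> * real n + K"
  shows "(\<Sum>i<n. e i * b i) \<le> \<epsilon> * (\<Sum>i<n. b i) + K * b 0"
proof -
  define T where "T n = (\<Sum>i<n. e i - \<epsilon>)" for n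
  have T: "T n \<le> K" for n
    using assms(3)[of n] by (simp add: T_def sum_subtractf mult.commute)
  have mono: "b (Suc n) \<le> b n" for n using assms(1) by (simp add: decseq_SucD)
  \<comment> \<open>only the last weight multiplies a partial sum; the weight lost before it is charged at the bound \<open>K\<close>\<close>
  have step: "(\<Sum>i<Suc n. (e i - \<epsilon>) * b i) \<le> T (Suc n) * b n + K * (b 0 - b n)" for n
  proof (induction n)
    case (Suc n)
    have "(\<Sum>i<Suc (Suc n). (e i - \<epsilon>) * b i)
        \<le> T (Suc n) * b n + K * (b 0 - b n) + (e (Suc n) - \<epsilon>) * b (Suc n)"
      using Suc by simp
    also have "\<dots> = T (Suc (Suc n)) * b (Suc n) + T (Suc n) * (b n - b (Suc n)) + K * (b 0 - b n)"
      by (simp add: T_def algebra_simps)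
    also have "\<dots> \<le> T (Suc (Suc n)) * b (Suc n) + K * (b n - b (Suc n)) + K * (b 0 - b n)"
      using mult_right_mono[OF T[of "Suc n"], of "b n - b (Suc n)"] mono[of n] by simp
    finally show ?case by (simp add: algebra_simps)
  qed (simp add: T_def)
  have "(\<Sum>i<n. (e i - \<epsilon>) * b i) \<le> K * b 0"
  proof (cases n)
    case 0
    then show ?thesis using assms(2)[of 0] T[of 0] by (simp add: T_def)
  next
    case (Suc m)
    have "T (Suc m) * b m \<le> K * b m" using T assms(2) by (intro mult_right_mono) auto
    then show ?thesis using step[of m] Suc by (simp add: algebra_simps)
  qed
  then show ?thesis by (simp add: algebra_simps sum_subtractf sum_distrib_left)
qed

text \<open>
  A Cesaro average may be replaced by its limit inside a sum with decreasing weights: the deviations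
  \<open>a i - \<pi>\<close> have partial sums \<open>o(n)\<close>, and \<open>abel_bound\<close>, applied to them and to their negatives, makes
  their weighted sum negligible against \<open>\<Sum>i<n. b i\<close>.
\<close>
lemma weighted_sum_asymp:
  fixes a b g :: "nat \<Rightarrow> real"
  assumes avg: "(\<lambda>n. (\<Sum>i<n. a i) / real n) \<longlonglongrightarrow> \<pi>"
    and b: "decseq b" "\<And>n. b n \<ge> 0"
    and g: "(\<lambda>n. (\<Sum>i<n. b i) / g n) \<longlonglongrightarrow> L" "filterlim g at_top sequentially"
  shows "(\<lambda>n. (\<Sum>i<n. a i * b i) / g n) \<longlonglongrightarrow> \<pi> * L"
proof -
  define e where "e i = a i - \<pi>" for i
  have small: "\<exists>K. \<forall>n. \<bar>\<Sum>i<n. e i\<bar> \<le> \<epsilon> * real n + K" if "\<epsilon> > 0" for \<epsilon>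
  proof -
    obtain N where N: "\<And>n. n \<ge> N \<Longrightarrow> \<bar>(\<Sum>i<n. a i) / real n - \<pi>\<bar> < \<epsilon>"
      using LIMSEQ_D[OF avg \<open>\<epsilon> > 0\<close>] by auto
    have "\<bar>\<Sum>i<n. e i\<bar> \<le> \<epsilon> * real n + (\<Sum>i<N. \<bar>e i\<bar>)" for n
    proof (cases "n \<ge> N \<and> n > 0")
      case True
      then have "(\<Sum>i<n. e i) = ((\<Sum>i<n. a i) / real n - \<pi>) * real n"
        by (simp add: e_def sum_subtractf field_simps)
      then have "\<bar>\<Sum>i<n. e i\<bar> = \<bar>(\<Sum>i<n. a i) / real n - \<pi>\<bar> * real n"
        by (simp add: abs_mult)
      also have "\<dots> \<le> \<epsilon> * real n" using N[of n] True by (intro mult_right_mono) auto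
      finally show ?thesis by (simp add: sum_nonneg add_increasing2)
    next
      case False
      have "\<bar>\<Sum>i<n. e i\<bar> \<le> (\<Sum>i<n. \<bar>e i\<bar>)" by (rule sum_abs)
      also have "\<dots> \<le> (\<Sum>i<N. \<bar>e i\<bar>)" using False by (intro sum_mono2) auto
      finally show ?thesis using that by (simp add: add_increasing)
    qed
    then show ?thesis by blast
  qed
  have "(\<lambda>n. (\<Sum>i<n. e i * b i) / g n) \<longlonglongrightarrow> 0"
  proof (rule LIMSEQ_I)
    fix r :: real assume r: "r > 0"
    define \<epsilon> where "\<epsilon> = r / (2 * (\<bar>L\<bar> + 1))"
    have \<epsilon>: "\<epsilon> > 0" using r by (simp add: \<epsilon>_def)
    obtain K where K: "\<And>n. \<bar>\<Sum>i<n. e i\<bar> \<le> \<epsilon> * real n + K" using small[OF \<epsilon>] by blast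
    have up: "(\<Sum>i<n. e i * b i) \<le> \<epsilon> * (\<Sum>i<n. b i) + K * b 0" for n
      by (rule abel_bound[OF b]) (use K in \<open>auto simp: abs_le_iff\<close>)
    have "(\<Sum>i<n. - e i * b i) \<le> \<epsilon> * (\<Sum>i<n. b i) + K * b 0" for n
      by (rule abel_bound[OF b]) (use K in \<open>auto simp: abs_le_iff sum_negf\<close>)
    with up have bound: "\<bar>\<Sum>i<n. e i * b i\<bar> \<le> \<epsilon> * (\<Sum>i<n. b i) + K * b 0" for n
      by (simp add: abs_le_iff sum_negf)
    have "(\<lambda>n. \<epsilon> * ((\<Sum>i<n. b i) / g n) + K * b 0 / g n) \<longlonglongrightarrow> \<epsilon> * L + 0"
      by (intro tendsto_intros g tendsto_divide_0[OF tendsto_const filterlim_at_top_imp_at_infinity])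
    moreover have "\<epsilon> * L + 0 < r"
    proof -
      have "\<epsilon> * L \<le> \<epsilon> * (\<bar>L\<bar> + 1)" using \<epsilon> by (intro mult_left_mono) auto
      also have "\<dots> = r / 2" by (simp add: \<epsilon>_def field_simps)
      finally show ?thesis using r by simp
    qed
    ultimately have "eventually (\<lambda>n. \<epsilon> * ((\<Sum>i<n. b i) / g n) + K * b 0 / g n < r) sequentially"
      by (rule order_tendstoD)
    moreover have "eventually (\<lambda>n. g n > 0) sequentially"
      using g(2) by (simp add: filterlim_at_top_dense)
    ultimately have "eventually (\<lambda>n. norm ((\<Sum>i<n. e i * b i) / g n - 0) < r) sequentially"
    proof eventually_elim
      case (elim n)
      have "\<bar>\<Sum>i<n. e i * b i\<bar> / g n \<le> (\<epsilon> * (\<Sum>i<n. b i) + K * b 0) / g n"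
        using elim bound by (intro divide_right_mono) auto
      then show ?case using elim by (simp add: add_divide_distrib)
    qed
    then show "\<exists>N. \<forall>n\<ge>N. norm ((\<Sum>i<n. e i * b i) / g n - 0) < r"
      by (simp add: eventually_sequentially)
  qed
  then have "(\<lambda>n. (\<Sum>i<n. e i * b i) / g n + \<pi> * ((\<Sum>i<n. b i) / g n)) \<longlonglongrightarrow> 0 + \<pi> * L"
    by (intro tendsto_intros g)
  then show ?thesis
    by (simp add: e_def algebra_simps sum_subtractf sum_distrib_left diff_divide_distrib)
qed

section \<open>Bounded martingale transforms\<close>

text \<open>
  The independence of \<open>V n\<close> from the past \<open>P n\<close> is stated through the real functions of the past: all
  conditional expectations needed below are then expectations of products.
\<close>
locale martingale_transform = prob_space M + filtration "space M" P
  for M :: "'w measure" and P :: "nat \<Rightarrow> 'w measure" +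
  fixes H V :: "nat \<Rightarrow> 'w \<Rightarrow> real" and B :: real
  assumes past_events: "\<And>n. sets (P n) \<subseteq> events"
    and H_past: "\<And>n. H n \<in> borel_measurable (P n)"
    and H_01: "\<And>n \<omega>. \<omega> \<in> space M \<Longrightarrow> H n \<omega> = 0 \<or> H n \<omega> = 1"
    and V_next: "\<And>n. V n \<in> borel_measurable (P (Suc n))"
    and V_bounded: "\<And>n \<omega>. \<omega> \<in> space M \<Longrightarrow> \<bar>V n \<omega>\<bar> \<le> B"
    and V_mean: "\<And>n. expectation (V n) = 0"
    and V_indep: "\<And>n g. g \<in> borel_measurable (P n) \<Longrightarrow> indep_var borel g borel (V n)"
    and B_pos: "B > 0"
begin

definition transform :: "nat \<Rightarrow> 'w \<Rightarrow> real" where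
  "transform n \<omega> = (\<Sum>i<n. H i \<omega> * V i \<omega>)"

lemma past_mono: "f \<in> borel_measurable (P m) \<Longrightarrow> m \<le> n \<Longrightarrow> f \<in> borel_measurable (P n)"
  for f :: "'w \<Rightarrow> real"
  using sets_F_mono[of m n] space_F by (auto simp: measurable_def)

lemma past_measurable: "f \<in> borel_measurable (P m) \<Longrightarrow> f \<in> borel_measurable M"
  for f :: "'w \<Rightarrow> real"
  using past_events[of m] space_F by (auto simp: measurable_def)

lemma transform_past: "transform n \<in> borel_measurable (P n)"
  unfolding transform_def
  by (intro borel_measurable_sum borel_measurable_times)
     (auto intro: past_mono[OF H_past] past_mono[OF V_next])

lemmas [measurable] = past_measurable[OF H_past] past_measurable[OF V_next] past_measurable[OF transform_past]

lemma transform_bounded: "\<omega> \<in> space M \<Longrightarrow> \<bar>transform n \<omega>\<bar> \<le> real n * B"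
proof -
  assume w: "\<omega> \<in> space M"
  have "\<bar>transform n \<omega>\<bar> \<le> (\<Sum>i<n. \<bar>H i \<omega> * V i \<omega>\<bar>)"
    unfolding transform_def by (rule sum_abs)
  also have "\<dots> \<le> (\<Sum>i<n. B)"
    using H_01[OF w] V_bounded[OF w] B_pos
    by (intro sum_mono) (auto simp: abs_mult, metis abs_0 abs_1 less_eq_real_def mult_1 mult_zero_left)
  finally show ?thesis by simp
qed

lemma exp_transform_integrable: "integrable M (\<lambda>\<omega>. exp (t * transform n \<omega>))"
proof (rule integrable_const_bound)
  show "AE \<omega> in M. norm (exp (t * transform n \<omega>)) \<le> exp (\<bar>t\<bar> * (real n * B))"
  proof (rule AE_I2)
    fix \<omega> assume w: "\<omega> \<in> space M"
    have "t * transform n \<omega> \<le> \<bar>t\<bar> * \<bar>transform n \<omega>\<bar>"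
      by (metis abs_ge_self abs_mult)
    also have "\<dots> \<le> \<bar>t\<bar> * (real n * B)"
      using transform_bounded[OF w] by (intro mult_left_mono) auto
    finally show "norm (exp (t * transform n \<omega>)) \<le> exp (\<bar>t\<bar> * (real n * B))" by simp
  qed
qed simp

lemma exp_V_integrable: "integrable M (\<lambda>\<omega>. exp (t * V n \<omega>))"
proof (rule integrable_const_bound)
  show "AE \<omega> in M. norm (exp (t * V n \<omega>)) \<le> exp (\<bar>t\<bar> * B)"
  proof (rule AE_I2)
    fix \<omega> assume w: "\<omega> \<in> space M"
    have "t * V n \<omega> \<le> \<bar>t\<bar> * \<bar>V n \<omega>\<bar>"
      by (metis abs_ge_self abs_mult)
    also have "\<dots> \<le> \<bar>t\<bar> * B"
      using V_bounded[OF w] by (intro mult_left_mono) auto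
    finally show "norm (exp (t * V n \<omega>)) \<le> exp (\<bar>t\<bar> * B)" by simp
  qed
qed simp

lemma exp_V_le:
  assumes "t > 0"
  shows "expectation (\<lambda>\<omega>. exp (t * V n \<omega>)) \<le> exp (t\<^sup>2 * B\<^sup>2 / 2)"
proof -
  interpret interval_bounded_random_variable M "V n" "-B" B
    using V_bounded by unfold_locales (auto simp: abs_le_iff intro!: AE_I2, smt (verit))
  have "ennreal (expectation (\<lambda>\<omega>. exp (t * V n \<omega>))) = (\<integral>\<^sup>+\<omega>. exp (t * V n \<omega>) \<partial>M)"
    by (intro nn_integral_eq_integral[symmetric] exp_V_integrable) auto
  also have "\<dots> \<le> ennreal (exp (t\<^sup>2 * (B - - B)\<^sup>2 / 8))"
    by (rule Hoeffdings_lemma_nn_integral_0) (use assms V_mean in auto)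
  finally show ?thesis
    by (simp add: power2_eq_square algebra_simps)
qed

text \<open>
  Azuma's bound on the exponential moments. As \<open>H n\<close> is 0 or 1, the new factor \<open>exp (t * H n * V n)\<close> equals
  \<open>H n * exp (t * V n) + (1 - H n)\<close>. This is affine in \<open>exp (t * V n)\<close>, with coefficients from the past, so
  independence turns its expectation into a product that Hoeffding's lemma bounds.
\<close>
lemma exp_transform_le:
  assumes "t > 0"
  shows "expectation (\<lambda>\<omega>. exp (t * transform n \<omega>)) \<le> exp (t\<^sup>2 * B\<^sup>2 / 2 * real n)"
proof (induction n)
  case 0
  show ?case by (simp add: transform_def prob_space)
next
  case (Suc n)
  let ?c = "exp (t\<^sup>2 * B\<^sup>2 / 2)"
  let ?E = "\<lambda>\<omega>. exp (t * transform n \<omega>)"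
  have c: "1 \<le> ?c" by simp
  have int_H: "integrable M (\<lambda>\<omega>. ?E \<omega> * H n \<omega>)"
  proof (rule Bochner_Integration.integrable_bound[OF exp_transform_integrable[of t n]])
    show "AE \<omega> in M. norm (?E \<omega> * H n \<omega>) \<le> norm (?E \<omega>)"
    proof (rule AE_I2)
      fix \<omega> assume "\<omega> \<in> space M"
      from H_01[OF this, of n] show "norm (?E \<omega> * H n \<omega>) \<le> norm (?E \<omega>)" by auto
    qed
  qed simp
  have int_H': "integrable M (\<lambda>\<omega>. ?E \<omega> * (1 - H n \<omega>))"
    using Bochner_Integration.integrable_diff[OF exp_transform_integrable[of t n] int_H]
    by (simp add: algebra_simps)
  have "(\<lambda>\<omega>. ?E \<omega> * H n \<omega>) \<in> borel_measurable (P n)"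
    using transform_past[of n] H_past[of n] by measurable
  from V_indep[OF this]
  have "indep_var borel (id \<circ> (\<lambda>\<omega>. ?E \<omega> * H n \<omega>)) borel ((\<lambda>x. exp (t * x)) \<circ> V n)"
    by (rule indep_var_compose) auto
  then have ind: "indep_var borel (\<lambda>\<omega>. ?E \<omega> * H n \<omega>) borel (\<lambda>\<omega>. exp (t * V n \<omega>))"
    by (simp add: comp_def)
  have prod: "expectation (\<lambda>\<omega>. ?E \<omega> * H n \<omega> * exp (t * V n \<omega>))
      = expectation (\<lambda>\<omega>. ?E \<omega> * H n \<omega>) * expectation (\<lambda>\<omega>. exp (t * V n \<omega>))"
    by (rule indep_var_lebesgue_integral[OF ind int_H exp_V_integrable])
  have int_prod: "integrable M (\<lambda>\<omega>. ?E \<omega> * H n \<omega> * exp (t * V n \<omega>))"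
    by (rule indep_var_integrable[OF ind int_H exp_V_integrable])
  have nonneg: "0 \<le> expectation (\<lambda>\<omega>. ?E \<omega> * H n \<omega>)" "0 \<le> expectation (\<lambda>\<omega>. ?E \<omega> * (1 - H n \<omega>))"
    using H_01 by (auto intro!: integral_nonneg_AE AE_I2) (smt (verit) exp_gt_zero mult_nonneg_nonneg)+
  have "expectation (\<lambda>\<omega>. exp (t * transform (Suc n) \<omega>))
      = expectation (\<lambda>\<omega>. ?E \<omega> * H n \<omega> * exp (t * V n \<omega>) + ?E \<omega> * (1 - H n \<omega>))"
  proof (rule Bochner_Integration.integral_cong[OF refl])
    fix \<omega> assume "\<omega> \<in> space M"
    from H_01[OF this, of n] show "exp (t * transform (Suc n) \<omega>)
        = ?E \<omega> * H n \<omega> * exp (t * V n \<omega>) + ?E \<omega> * (1 - H n \<omega>)"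
      by (auto simp: transform_def distrib_left exp_add)
  qed
  also have "\<dots> = expectation (\<lambda>\<omega>. ?E \<omega> * H n \<omega>) * expectation (\<lambda>\<omega>. exp (t * V n \<omega>))
      + expectation (\<lambda>\<omega>. ?E \<omega> * (1 - H n \<omega>))"
    by (subst Bochner_Integration.integral_add[OF int_prod int_H']) (simp add: prod)
  also have "\<dots> \<le> expectation (\<lambda>\<omega>. ?E \<omega> * H n \<omega>) * ?c + expectation (\<lambda>\<omega>. ?E \<omega> * (1 - H n \<omega>)) * ?c"
    using nonneg exp_V_le[OF assms, of n] c
    by (intro add_mono mult_left_mono) (auto intro: mult_left_le[of 1] simp: mult_le_cancel_left1)
  also have "\<dots> = expectation ?E * ?c"
    by (subst distrib_right[symmetric], subst Bochner_Integration.integral_add[OF int_H int_H', symmetric])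
       (simp add: algebra_simps)
  also have "\<dots> \<le> exp (t\<^sup>2 * B\<^sup>2 / 2 * real n) * ?c"
    using Suc.IH by (intro mult_right_mono) auto
  finally show ?case
    by (simp add: exp_add[symmetric] algebra_simps add_divide_distrib)
qed

lemma transform_upper_tail:
  assumes "a > 0" and "n > 0"
  shows "prob {\<omega> \<in> space M. a \<le> transform n \<omega>} \<le> exp (- a\<^sup>2 / (2 * B\<^sup>2 * real n))"
proof -
  \<comment> \<open>the minimiser of the exponent \<open>t\<^sup>2 * B\<^sup>2 * n / 2 - t * a\<close> in the Chernoff bound\<close>
  define t where "t = a / (B\<^sup>2 * real n)"
  have t: "t > 0" using assms B_pos by (simp add: t_def)
  have "prob {\<omega> \<in> space M. a \<le> transform n \<omega>} = prob {\<omega> \<in> space M. exp (t * a) \<le> exp (t * transform n \<omega>)}"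
    using t by (intro arg_cong[where f=prob]) auto
  also have "\<dots> \<le> expectation (\<lambda>\<omega>. exp (t * transform n \<omega>)) / exp (t * a)"
    using integral_Markov_inequality_measure[OF exp_transform_integrable[of t n], of "{}" "exp (t * a)"]
    by (auto)
  also have "\<dots> \<le> exp (t\<^sup>2 * B\<^sup>2 / 2 * real n) / exp (t * a)"
    by (intro divide_right_mono exp_transform_le t) auto
  also have "\<dots> = exp (- a\<^sup>2 / (2 * B\<^sup>2 * real n))"
    using assms B_pos by (simp add: exp_diff[symmetric] t_def field_simps power2_eq_square)
  finally show ?thesis .
qed

text \<open>
  At height \<open>\<epsilon> * n powr \<alpha>\<close> the Gaussian tail is \<open>exp (- c * n powr (2 * \<alpha> - 1))\<close>, which is summable exactly
  because \<open>\<alpha> > 1/2\<close>; Borel and Cantelli do the rest.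
\<close>
lemma transform_eventually_less:
  assumes "\<alpha> > 1 / 2" and "\<epsilon> > 0"
  shows "AE \<omega> in M. eventually (\<lambda>n. transform n \<omega> < \<epsilon> * real n powr \<alpha>) sequentially"
proof -
  define A where "A n = {\<omega> \<in> space M. \<epsilon> * real n powr \<alpha> \<le> transform n \<omega>}" for n
  define c where "c = \<epsilon>\<^sup>2 / (2 * B\<^sup>2)"
  define \<delta> where "\<delta> = 2 * \<alpha> - 1"
  have c: "c > 0" and \<delta>: "\<delta> > 0" using assms B_pos by (auto simp: c_def \<delta>_def)
  have A_le: "prob (A n) \<le> exp (- c * real n powr \<delta>)" if "n > 0" for n
  proof -
    have "prob (A n) \<le> exp (- (\<epsilon> * real n powr \<alpha>)\<^sup>2 / (2 * B\<^sup>2 * real n))"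
      unfolding A_def using assms that by (intro transform_upper_tail) auto
    also have "(\<epsilon> * real n powr \<alpha>)\<^sup>2 = \<epsilon>\<^sup>2 * (real n powr \<delta> * real n)"
      using that by (simp add: power_mult_distrib power2_eq_square powr_add[symmetric] \<delta>_def)
         (simp add: powr_diff powr_add[symmetric])
    finally show ?thesis using that by (simp add: c_def)
  qed
  have sum: "summable (\<lambda>n. exp (- c * real n powr \<delta>))"
  proof (rule summable_comparison_test_bigo)
    show "summable (\<lambda>n. norm (inverse (real n ^ 2)))"
      using inverse_power_summable[of 2, where 'a=real] by (simp add: power_inverse)
    show "(\<lambda>n. exp (- c * real n powr \<delta>)) \<in> O(\<lambda>n. inverse (real n ^ 2))"
      using c \<delta> by real_asymp
  qed
  have "AE \<omega> in M. eventually (\<lambda>n. \<omega> \<in> space M - A n) sequentially"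
  proof (rule borel_cantelli_AE1)
    show "summable (\<lambda>n. prob (A n))"
    proof (rule summable_comparison_test_ev[OF _ sum])
      show "eventually (\<lambda>n. norm (prob (A n)) \<le> exp (- c * real n powr \<delta>)) sequentially"
        using eventually_gt_at_top[of 0] by eventually_elim (simp only: real_norm_def abs_of_nonneg measure_nonneg A_le)
    qed
  qed (auto simp: A_def emeasure_eq_measure)
  then show ?thesis
    by eventually_elim (auto elim!: eventually_mono simp: A_def)
qed

lemma transform_over_powr_tendsto_0:
  assumes "\<alpha> > 1 / 2"
  shows "AE \<omega> in M. (\<lambda>n. transform n \<omega> / real n powr \<alpha>) \<longlonglongrightarrow> 0"
proof -
  interpret neg: martingale_transform M P H "\<lambda>n \<omega>. - V n \<omega>" B
  proof unfold_locales
    fix n and g :: "'w \<Rightarrow> real" assume "g \<in> borel_measurable (P n)"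
    from V_indep[OF this] have "indep_var borel (id \<circ> g) borel (uminus \<circ> V n)"
      by (rule indep_var_compose) auto
    then show "indep_var borel g borel (\<lambda>\<omega>. - V n \<omega>)" by (simp add: comp_def)
  qed (use past_events H_past H_01 V_next V_bounded V_mean B_pos in auto)
  have neg: "neg.transform n \<omega> = - transform n \<omega>" for n \<omega>
    by (simp add: neg.transform_def transform_def sum_negf)
  have "AE \<omega> in M. \<forall>k::nat. eventually (\<lambda>n. transform n \<omega> < inverse (Suc k) * real n powr \<alpha>) sequentially
      \<and> eventually (\<lambda>n. - transform n \<omega> < inverse (Suc k) * real n powr \<alpha>) sequentially"
    unfolding AE_all_countable
    using transform_eventually_less[OF assms] neg.transform_eventually_less[OF assms] unfolding neg by auto
  then show ?thesis
  proof eventually_elim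
    case (elim \<omega>)
    show ?case
    proof (rule LIMSEQ_I)
      fix r :: real assume "r > 0"
      then obtain k where k: "inverse (Suc k) < r" using reals_Archimedean by blast
      have "eventually (\<lambda>n. \<bar>transform n \<omega>\<bar> < inverse (Suc k) * real n powr \<alpha>) sequentially"
        using elim[rule_format, of k] by (auto elim: eventually_elim2)
      then have "eventually (\<lambda>n. norm (transform n \<omega> / real n powr \<alpha> - 0) < r) sequentially"
        using eventually_gt_at_top[of 0]
      proof eventually_elim
        case (elim n)
        have "\<bar>transform n \<omega>\<bar> / real n powr \<alpha> < inverse (Suc k)"
          using elim by (simp add: field_simps)
        then show ?case using k by simp
      qed
      then show "\<exists>N. \<forall>n\<ge>N. norm (transform n \<omega> / real n powr \<alpha> - 0) < r"
        by (simp add: eventually_sequentially)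
    qed
  qed
qed

end

section \<open>Independence of steps, cookies and coins\<close>

lemma (in prob_space) iid_measurable: "iid Z \<Longrightarrow> i \<ge> 1 \<Longrightarrow> random_variable borel (Z i)"
  by (auto simp: iid_def indep_vars_def)

text \<open>
  This links two forms of independence: inside one sequence it speaks of events of single members, between
  sequences of events in the product space. A finite intersection is of both kinds. The factor \<open>space M\<close> is
  there for the empty intersection, which is \<open>UNIV\<close>.
\<close>
lemma (in prob_space) iid_cylinder:
  fixes Z :: "nat \<Rightarrow> 'a \<Rightarrow> 'b::topological_space"
  assumes Z: "iid Z" and J: "finite J" "J \<subseteq> {1..}"
    and A: "\<And>i. i \<in> J \<Longrightarrow> A i \<in> {Z i -` B \<inter> space M | B. B \<in> sets borel}"
  shows "prob (space M \<inter> (\<Inter>i\<in>J. A i)) = (\<Prod>i\<in>J. prob (A i))"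
    and "\<exists>S\<in>sets seq_space. space M \<inter> (\<Inter>i\<in>J. A i) = as_seq Z -` S \<inter> space M"
proof -
  show "prob (space M \<inter> (\<Inter>i\<in>J. A i)) = (\<Prod>i\<in>J. prob (A i))"
  proof (cases "J = {}")
    case False
    have "indep_sets (\<lambda>i. {Z i -` B \<inter> space M | B. B \<in> sets borel}) {1..}"
      using Z by (simp add: iid_def indep_vars_def2)
    from indep_setsD[OF this J(2) False J(1), of A] A
    have "prob (\<Inter>i\<in>J. A i) = (\<Prod>i\<in>J. prob (A i))" by blast
    moreover have "space M \<inter> (\<Inter>i\<in>J. A i) = (\<Inter>i\<in>J. A i)"
      using A False by fastforce
    ultimately show ?thesis by simp
  qed (simp add: prob_space)
  have "\<forall>i\<in>J. \<exists>B. B \<in> sets borel \<and> A i = Z i -` B \<inter> space M" using A by blast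
  then obtain B where B: "\<And>i. i \<in> J \<Longrightarrow> B i \<in> sets borel" "\<And>i. i \<in> J \<Longrightarrow> A i = Z i -` B i \<inter> space M"
    by metis
  let ?S = "{f \<in> space seq_space. \<forall>i\<in>J. f i \<in> B i}"
  have "?S \<in> sets seq_space"
  proof (rule sets.sets_Collect_finite_All[OF _ J(1)])
    fix i assume i: "i \<in> J"
    then have "(\<lambda>f. f i) \<in> measurable seq_space (borel :: 'b measure)"
      using J(2) by (intro measurable_component_singleton) auto
    from measurable_sets[OF this B(1)[OF i]]
    show "{f \<in> space seq_space. f i \<in> B i} \<in> sets seq_space"
      by (simp add: vimage_def Int_def conj_commute)
  qed
  moreover have "space M \<inter> (\<Inter>i\<in>J. A i) = as_seq Z -` ?S \<inter> space M"
    using B(2) J(2) by (auto simp: space_PiM)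
  ultimately show "\<exists>S\<in>sets seq_space. space M \<inter> (\<Inter>i\<in>J. A i) = as_seq Z -` S \<inter> space M"
    by blast
qed

lemma Int_stable_preimages: "Int_stable {f -` B \<inter> \<Omega> | B. B \<in> sets N}"
proof (rule Int_stableI, clarify)
  fix B B' assume "B \<in> sets N" "B' \<in> sets N"
  then show "\<exists>C. f -` B \<inter> \<Omega> \<inter> (f -` B' \<inter> \<Omega>) = f -` C \<inter> \<Omega> \<and> C \<in> sets N"
    by (intro exI[of _ "B \<inter> B'"]) auto
qed

text \<open>
  One index type for the three kinds of randomness, although their values live in different types. The
  independence of the whole family is then a single statement about set systems indexed by sources, and every
  regrouping of sources into disjoint blocks comes from one general fact.
\<close>
datatype source = Step nat | Cookie nat | Coin nat

definition sources :: "nat set \<Rightarrow> source set" where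
  "sources T = Step ` T \<union> Cookie ` T \<union> Coin ` T"

lemma borel_measurable_component:
  fixes f :: "'a \<Rightarrow> real ^ 'd::finite"
  assumes "f \<in> borel_measurable N"
  shows "(\<lambda>x. f x $ j) \<in> borel_measurable N"
  by (rule measurable_compose[OF assms])
     (intro borel_measurable_continuous_onI continuous_on_component continuous_on_id)

lemma pred_nonzero:
  fixes f :: "'a \<Rightarrow> real ^ 'd::finite"
  assumes [measurable]: "f \<in> borel_measurable N"
  shows "Measurable.pred N (\<lambda>x. f x \<noteq> 0)"
  by measurable

context excited_random_walk
begin

definition source_events :: "source \<Rightarrow> 'w set set" where
  "source_events s = (case s of
      Step i \<Rightarrow> {\<xi> i -` B \<inter> space M | B. B \<in> sets borel}
    | Cookie i \<Rightarrow> {\<gamma> i -` B \<inter> space M | B. B \<in> sets borel}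
    | Coin i \<Rightarrow> {U i -` B \<inter> space M | B. B \<in> sets borel})"

definition info :: "source set \<Rightarrow> 'w measure" where
  "info A = sigma (space M) (\<Union>s\<in>A. source_events s)"

lemma xi_measurable: "i \<ge> 1 \<Longrightarrow> \<xi> i \<in> borel_measurable M"
  and gamma_measurable: "i \<ge> 1 \<Longrightarrow> \<gamma> i \<in> borel_measurable M"
  and U_measurable: "i \<ge> 1 \<Longrightarrow> U i \<in> borel_measurable M"
  using iid_measurable[OF xi_iid] iid_measurable[OF gamma_iid] iid_measurable[OF U_iid] by auto

lemma source_events_subset: "s \<in> sources {1..} \<Longrightarrow> source_events s \<subseteq> events"
  using xi_measurable gamma_measurable U_measurable
  by (auto simp: sources_def source_events_def intro!: measurable_sets)

text \<open>
  An intersection of source events factors in two stages: first into its parts belonging to steps, cookies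
  and coins, because these three sequences are independent, and then inside each part, because each sequence
  is i.i.d.
\<close>
lemma indep_sources: "indep_sets source_events (sources {1..})"
proof (rule indep_setsI)
  fix A J assume J: "J \<noteq> {}" "J \<subseteq> sources {1..}" "finite J" and A: "\<forall>s\<in>J. A s \<in> source_events s"
  define J0 J1 J2 where "J0 = Step -` J" and "J1 = Cookie -` J" and "J2 = Coin -` J"
  have fin: "finite J0" "finite J1" "finite J2"
    unfolding J0_def J1_def J2_def using J(3) by (auto intro!: finite_vimageI simp: inj_on_def)
  have sub: "J0 \<subseteq> {1..}" "J1 \<subseteq> {1..}" "J2 \<subseteq> {1..}"
    using J(2) by (auto simp: J0_def J1_def J2_def sources_def)
  have J_eq: "J = Step ` J0 \<union> (Cookie ` J1 \<union> Coin ` J2)"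
    using J(2) by (auto simp: J0_def J1_def J2_def sources_def)
  define P0 where "P0 = space M \<inter> (\<Inter>i\<in>J0. A (Step i))"
  define P1 where "P1 = space M \<inter> (\<Inter>i\<in>J1. A (Cookie i))"
  define P2 where "P2 = space M \<inter> (\<Inter>i\<in>J2. A (Coin i))"
  have A0: "A (Step i) \<in> {\<xi> i -` B \<inter> space M | B. B \<in> sets borel}" if "i \<in> J0" for i
    using A that by (force simp: J0_def source_events_def)
  have A1: "A (Cookie i) \<in> {\<gamma> i -` B \<inter> space M | B. B \<in> sets borel}" if "i \<in> J1" for i
    using A that by (force simp: J1_def source_events_def)
  have A2: "A (Coin i) \<in> {U i -` B \<inter> space M | B. B \<in> sets borel}" if "i \<in> J2" for i
    using A that by (force simp: J2_def source_events_def)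
  note c0 = iid_cylinder[OF xi_iid fin(1) sub(1), of "\<lambda>i. A (Step i)", OF A0, folded P0_def]
  note c1 = iid_cylinder[OF gamma_iid fin(2) sub(2), of "\<lambda>i. A (Cookie i)", OF A1, folded P1_def]
  note c2 = iid_cylinder[OF U_iid fin(3) sub(3), of "\<lambda>i. A (Coin i)", OF A2, folded P2_def]
  obtain S0 where S0: "S0 \<in> sets seq_space" "P0 = as_seq \<xi> -` S0 \<inter> space M" using c0(2) by auto
  obtain S1 where S1: "S1 \<in> sets seq_space" "P1 = as_seq \<gamma> -` S1 \<inter> space M" using c1(2) by auto
  obtain S2 where S2: "S2 \<in> sets seq_space" "P2 = as_seq U -` S2 \<inter> space M" using c2(2) by auto
  have P01: "P0 \<inter> P1 = (\<lambda>\<omega>. (as_seq \<xi> \<omega>, as_seq \<gamma> \<omega>)) -` (S0 \<times> S1) \<inter> space M"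
    by (auto simp: S0 S1)
  have "prob (P2 \<inter> (P0 \<inter> P1)) = prob P2 * prob (P0 \<inter> P1)"
    using U_indep unfolding indep_rv_def
    by (elim conjE, intro indep_setD) (use S0(1) S1(1) S2 P01 in \<open>auto intro!: exI[of _ S2] exI[of _ "S0 \<times> S1"]\<close>)
  also have "prob (P0 \<inter> P1) = prob P0 * prob P1"
    using indep_varD[OF xi_gamma_indep S0(1) S1(1)]
    unfolding P01[symmetric] S0(2)[symmetric] S1(2)[symmetric] .
  finally have prob: "prob (P2 \<inter> (P0 \<inter> P1)) =
      (\<Prod>i\<in>J2. prob (A (Coin i))) * ((\<Prod>i\<in>J0. prob (A (Step i))) * (\<Prod>i\<in>J1. prob (A (Cookie i))))"
    using c0(1) c1(1) c2(1) by simp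
  have "\<And>s. s \<in> J \<Longrightarrow> A s \<subseteq> space M"
    using A source_events_subset J(2) sets.sets_into_space by blast
  then have "(\<Inter>s\<in>J. A s) = space M \<inter> (\<Inter>s\<in>J. A s)"
    using J(1) by blast
  then have "(\<Inter>s\<in>J. A s) = P2 \<inter> (P0 \<inter> P1)"
    unfolding P0_def P1_def P2_def J_eq by blast
  moreover have "(\<Prod>s\<in>J. prob (A s)) = (\<Prod>i\<in>J2. prob (A (Coin i))) *
      ((\<Prod>i\<in>J0. prob (A (Step i))) * (\<Prod>i\<in>J1. prob (A (Cookie i))))"
    unfolding J_eq using fin
    by (subst prod.union_disjoint, simp, simp, force, subst prod.union_disjoint, simp, simp, force)
       (simp add: prod.reindex inj_on_def)
  ultimately show "prob (\<Inter>s\<in>J. A s) = (\<Prod>s\<in>J. prob (A s))" using prob by simp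
qed (use source_events_subset in blast)

lemma source_events_Pow: "(\<Union>s\<in>A. source_events s) \<subseteq> Pow (space M)"
  by (auto simp: source_events_def split: source.splits)

lemma space_info [simp]: "space (info A) = space M"
  by (simp add: info_def source_events_Pow)

lemma sets_info: "sets (info A) = sigma_sets (space M) (\<Union>s\<in>A. source_events s)"
  by (simp add: info_def source_events_Pow)

lemma sets_info_mono: "A \<subseteq> B \<Longrightarrow> sets (info A) \<subseteq> sets (info B)"
  unfolding sets_info by (intro sigma_sets_mono') auto

lemma sets_info_events: "A \<subseteq> sources {1..} \<Longrightarrow> sets (info A) \<subseteq> events"
  unfolding sets_info using source_events_subset by (intro sets.sigma_sets_subset) auto

lemma info_mono: "f \<in> measurable (info A) N \<Longrightarrow> A \<subseteq> B \<Longrightarrow> f \<in> measurable (info B) N"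
  using sets_info_mono[of A B] by (auto simp: measurable_def)

lemma info_random_variable: "f \<in> measurable (info A) N \<Longrightarrow> A \<subseteq> sources {1..} \<Longrightarrow> f \<in> measurable M N"
  using sets_info_events[of A] by (auto simp: measurable_def)

lemma infoI:
  assumes "s \<in> A" and "\<And>B. B \<in> sets N \<Longrightarrow> f -` B \<inter> space M \<in> source_events s"
    and "space N = UNIV"
  shows "f \<in> measurable (info A) N"
  using assms by (intro measurableI) (auto simp: sets_info)

lemma info_xi: "Step i \<in> A \<Longrightarrow> \<xi> i \<in> borel_measurable (info A)"
  and info_gamma: "Cookie i \<in> A \<Longrightarrow> \<gamma> i \<in> borel_measurable (info A)"
  and info_U: "Coin i \<in> A \<Longrightarrow> U i \<in> borel_measurable (info A)"
  by (erule infoI; auto simp: source_events_def)+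

lemma indep_info:
  assumes "A \<subseteq> sources {1..}" "B \<subseteq> sources {1..}" "A \<inter> B = {}"
    and f: "f \<in> measurable (info A) N" and g: "g \<in> measurable (info B) N'"
  shows "indep_var N f N' g"
proof -
  have "indep_sets (\<lambda>b. sigma_sets (space M) (\<Union>s\<in>case_bool A B b. source_events s)) UNIV"
  proof (rule indep_sets_collect_sigma)
    show "indep_sets source_events (\<Union>b\<in>UNIV. case_bool A B b)"
      by (rule indep_sets_mono_index[OF _ indep_sources]) (use assms in \<open>auto simp: UNIV_bool\<close>)
    show "disjoint_family_on (case_bool A B) UNIV"
      using assms(3) by (auto simp: disjoint_family_on_def split: bool.splits)
    show "Int_stable (source_events i)" for i
      by (cases i) (simp_all add: source_events_def Int_stable_preimages)
  qed
  then have "indep_set (sets (info A)) (sets (info B))"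
    unfolding indep_set_def sets_info by (rule indep_sets_mono_sets) (auto split: bool.splits)
  then show ?thesis
    unfolding indep_var_iff_indep_rv indep_rv_def
    using info_random_variable[OF f] info_random_variable[OF g] assms(1,2)
      measurable_sets[OF f] measurable_sets[OF g]
    by (auto simp: indep_sets2_eq)
qed

lemma sources_mono: "S \<subseteq> T \<Longrightarrow> sources S \<subseteq> sources T"
  by (auto simp: sources_def)

text \<open>
  The times are cut into successive blocks by \<open>\<tau>\<close>. Single times suit the walk itself; blocks of length \<open>m\<close>
  are needed for events that look \<open>m\<close> steps ahead.
\<close>
lemma transform_of_blocks:
  fixes \<tau> :: "nat \<Rightarrow> nat" and B :: real
  assumes "incseq \<tau>" and "B > 0"
    and "\<And>n. H n \<in> borel_measurable (info (sources {1..\<tau> n}))"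
    and "\<And>n \<omega>. \<omega> \<in> space M \<Longrightarrow> H n \<omega> = 0 \<or> H n \<omega> = 1"
    and V: "\<And>n. V n \<in> borel_measurable (info (sources {\<tau> n<..\<tau> (Suc n)}))"
    and "\<And>n \<omega>. \<omega> \<in> space M \<Longrightarrow> \<bar>V n \<omega>\<bar> \<le> B"
    and "\<And>n. expectation (V n) = 0"
  shows "martingale_transform M (\<lambda>n. info (sources {1..\<tau> n})) H V B"
proof unfold_locales
  show "space (info (sources {1..\<tau> n})) = space M" for n by simp
  show "sets (info (sources {1..\<tau> m})) \<le> sets (info (sources {1..\<tau> n}))" if "m \<le> n" for m n
    using incseqD[OF assms(1) that] by (intro sets_info_mono sources_mono) auto
  show "sets (info (sources {1..\<tau> n})) \<subseteq> events" for n
    by (intro sets_info_events sources_mono) auto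
  show "V n \<in> borel_measurable (info (sources {1..\<tau> (Suc n)}))" for n
    using V by (rule info_mono) (auto intro!: sources_mono)
  show "indep_var borel g borel (V n)" if "g \<in> borel_measurable (info (sources {1..\<tau> n}))"
    for n and g :: "'w \<Rightarrow> real"
    by (rule indep_info[OF _ _ _ that V]) (auto simp: sources_def)
qed (use assms in auto)

lemma transform_tendsto_0:
  fixes \<tau> :: "nat \<Rightarrow> nat" and B \<alpha> :: real
  assumes "\<alpha> > 1 / 2" and "incseq \<tau>" and "B > 0"
    and "\<And>n. H n \<in> borel_measurable (info (sources {1..\<tau> n}))"
    and "\<And>n \<omega>. \<omega> \<in> space M \<Longrightarrow> H n \<omega> = 0 \<or> H n \<omega> = 1"
    and "\<And>n. V n \<in> borel_measurable (info (sources {\<tau> n<..\<tau> (Suc n)}))"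
    and "\<And>n \<omega>. \<omega> \<in> space M \<Longrightarrow> \<bar>V n \<omega>\<bar> \<le> B"
    and "\<And>n. expectation (V n) = 0"
  shows "AE \<omega> in M. (\<lambda>n. (\<Sum>i<n. H i \<omega> * V i \<omega>) / real n powr \<alpha>) \<longlonglongrightarrow> 0"
proof -
  have tr: "martingale_transform M (\<lambda>n. info (sources {1..\<tau> n})) H V B"
    by (rule transform_of_blocks) (use assms in auto)
  from martingale_transform.transform_over_powr_tendsto_0[OF tr assms(1)]
  show ?thesis unfolding martingale_transform.transform_def[OF tr] .
qed

section \<open>The walk as a functional of its sources\<close>

definition fresh :: "nat \<Rightarrow> 'w \<Rightarrow> real" where
  "fresh n \<omega> = of_bool (\<not> revisits X n \<omega>)"

lemma X_Suc:
  assumes "\<omega> \<in> space M"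
  shows "X (Suc n) \<omega> = X n \<omega> +
    (if \<not> revisits X n \<omega> \<and> U (Suc n) \<omega> \<le> p (Suc n) then \<gamma> (Suc n) \<omega> else \<xi> (Suc n) \<omega>)"
proof -
  have "X n \<omega> = (\<Sum>i = 1..n.
          of_bool (revisits X (i - 1) \<omega>) *\<^sub>R \<xi> i \<omega>
        + of_bool (\<not> revisits X (i - 1) \<omega> \<and> U i \<omega> > p i) *\<^sub>R \<xi> i \<omega>
        + of_bool (\<not> revisits X (i - 1) \<omega> \<and> U i \<omega> \<le> p i) *\<^sub>R \<gamma> i \<omega>)"
    using X_zero[OF assms] X_eq[OF _ assms, of n] by (cases "n = 0") auto
  then show ?thesis
    using X_eq[OF _ assms, of "Suc n"] by auto
qed

lemma revisits_info:
  assumes "\<And>k. k \<le> n \<Longrightarrow> X k \<in> borel_measurable N"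
  shows "Measurable.pred N (revisits X n)"
proof -
  have "Measurable.pred N (\<lambda>\<omega>. \<exists>k\<in>{..<n}. X k \<omega> = X n \<omega>)"
    using assms measurable_equality_set unfolding pred_def
    by (intro sets.sets_Collect_finite_Ex) auto
  moreover have "revisits X n = (\<lambda>\<omega>. \<exists>k\<in>{..<n}. X k \<omega> = X n \<omega>)"
    by (auto simp: revisits_def fun_eq_iff)
  ultimately show ?thesis by simp
qed

text \<open>
  Everything rests on this: the position at time \<open>n\<close> uses no source later than time \<open>n\<close>. The recursion
  \<open>X_Suc\<close> carries the measurability along, with \<open>revisits\<close> depending on earlier positions only.
\<close>
lemma X_info: "X n \<in> borel_measurable (info (sources {1..n}))"
proof (induction n rule: less_induct)
  case (less n)
  show ?case
  proof (cases n)
    case 0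
    have "(\<lambda>_. 0) \<in> borel_measurable (info (sources {1..n}))" by simp
    then show ?thesis
      by (rule measurable_cong[THEN iffD1, rotated]) (use X_zero 0 in auto)
  next
    case (Suc m)
    let ?N = "info (sources {1..n})"
    have X: "X k \<in> borel_measurable ?N" if "k \<le> m" for k
      by (rule info_mono[OF less]) (use that Suc in \<open>auto intro!: sources_mono\<close>)
    have [measurable]: "Measurable.pred ?N (revisits X m)" by (rule revisits_info) (rule X)
    have [measurable]: "X m \<in> borel_measurable ?N" by (rule X) simp
    have [measurable]: "U n \<in> borel_measurable ?N" "\<gamma> n \<in> borel_measurable ?N" "\<xi> n \<in> borel_measurable ?N"
      by (rule info_U info_gamma info_xi; use Suc in \<open>simp add: sources_def\<close>)+
    have "(\<lambda>\<omega>. X m \<omega> + (if \<not> revisits X m \<omega> \<and> U n \<omega> \<le> p n then \<gamma> n \<omega> else \<xi> n \<omega>)) \<in> borel_measurable ?N"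
      by measurable
    then show ?thesis
      by (rule measurable_cong[THEN iffD1, rotated]) (use X_Suc Suc in auto)
  qed
qed

lemma fresh_info: "fresh n \<in> borel_measurable (info (sources {1..n}))"
proof -
  have [measurable]: "Measurable.pred (info (sources {1..n})) (revisits X n)"
    by (rule revisits_info, rule info_mono[OF X_info]) (auto intro!: sources_mono)
  show ?thesis unfolding fresh_def[abs_def] by measurable
qed

lemma gamma_integrable:
  assumes "i \<ge> 1"
  shows "integrable M (\<gamma> i)"
proof -
  obtain K where "K > 0" and K: "\<forall>n\<ge>1. \<forall>\<omega>\<in>space M. norm (\<xi> n \<omega>) \<le> K \<and> norm (\<gamma> n \<omega>) \<le> K"
    using bounded_jumps by blast
  show ?thesis
  proof (rule integrable_const_bound[of _ K])
    show "AE \<omega> in M. norm (\<gamma> i \<omega>) \<le> K" using K assms by (intro AE_I2) blast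
  qed (rule gamma_measurable[OF assms])
qed

lemma xi_component_integrable: "i \<ge> 1 \<Longrightarrow> integrable M (\<lambda>\<omega>. \<xi> i \<omega> $ j)"
  by (rule integrable_bounded_linear[OF bounded_linear_vec_nth]) (simp add: xi_mean)

lemma gamma_component_integrable: "i \<ge> 1 \<Longrightarrow> integrable M (\<lambda>\<omega>. \<gamma> i \<omega> $ j)"
  by (rule integrable_bounded_linear[OF bounded_linear_vec_nth]) (simp add: gamma_integrable)

lemma xi_component_mean: "i \<ge> 1 \<Longrightarrow> expectation (\<lambda>\<omega>. \<xi> i \<omega> $ j) = 0"
  using integral_bounded_linear[OF bounded_linear_vec_nth, of M "\<xi> i" j] xi_mean[of i] by simp

lemma gamma_component_mean:
  assumes "i \<ge> 1"
  shows "expectation (\<lambda>\<omega>. \<gamma> i \<omega> $ j) = expectation (\<gamma> 1) $ j"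
proof -
  have "distr M borel (\<gamma> i) = distr M borel (\<gamma> 1)"
    using gamma_iid assms unfolding iid_def by blast
  then have "expectation (\<gamma> i) = expectation (\<gamma> 1)"
    using integral_distr[OF gamma_measurable[OF assms], of "\<lambda>x. x"]
      integral_distr[OF gamma_measurable[of 1], of "\<lambda>x. x"] by simp
  then show ?thesis
    using integral_bounded_linear[OF bounded_linear_vec_nth gamma_integrable[OF assms], of j] by simp
qed

lemma coin_prob:
  assumes "i \<ge> 1"
  shows "prob {\<omega> \<in> space M. U i \<omega> \<le> p i} = p i"
proof -
  have p: "0 < p i" "p i \<le> 1" using p_range[OF assms] by auto
  have "prob {\<omega> \<in> space M. U i \<omega> \<le> p i} = measure (distr M borel (U i)) {..p i}"
    using U_measurable[OF assms] by (subst measure_distr) (auto intro!: arg_cong[where f=prob])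
  also have "\<dots> = measure (uniform_measure lborel {0..1}) {..p i}"
    by (simp only: U_uniform[OF assms])
  also have "\<dots> = p i"
  proof -
    have "{0..1} \<inter> {..p i} = {0..p i}" using p by auto
    then show ?thesis using p by simp
  qed
  finally show ?thesis .
qed

definition coin :: "nat \<Rightarrow> 'w \<Rightarrow> real" where
  "coin i \<omega> = of_bool (U i \<omega> \<le> p i)"

lemma coin_info: "Coin i \<in> A \<Longrightarrow> coin i \<in> borel_measurable (info A)"
proof -
  assume "Coin i \<in> A"
  from info_U[OF this] have [measurable]: "U i \<in> borel_measurable (info A)" .
  show ?thesis unfolding coin_def[abs_def] by measurable
qed

lemma coin_measurable: "i \<ge> 1 \<Longrightarrow> coin i \<in> borel_measurable M"
  using coin_info[of i "{Coin i}"] by (rule info_random_variable) (auto simp: sources_def)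

lemma coin_integrable: "i \<ge> 1 \<Longrightarrow> integrable M (coin i)"
  by (rule integrable_const_bound[of _ 1]) (auto simp: coin_measurable coin_def)

lemma coin_mean: "i \<ge> 1 \<Longrightarrow> expectation (coin i) = p i"
proof -
  assume i: "i \<ge> 1"
  have "{\<omega> \<in> space M. U i \<omega> \<le> p i} \<in> events"
    using U_measurable[OF i] by measurable
  moreover have "expectation (coin i) = expectation (indicator {\<omega> \<in> space M. U i \<omega> \<le> p i})"
    by (intro Bochner_Integration.integral_cong) (auto simp: coin_def indicator_def)
  ultimately show ?thesis using coin_prob[OF i] by simp
qed

section \<open>Fluctuations\<close>

lemma step_sum_small:
  assumes "\<alpha> > 1 / 2"
  shows "AE \<omega> in M. (\<lambda>n. (\<Sum>i<n. \<xi> (Suc i) \<omega> $ j) / real n powr \<alpha>) \<longlonglongrightarrow> 0"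
proof -
  obtain K where "K > 0" and K: "\<forall>n\<ge>1. \<forall>\<omega>\<in>space M. norm (\<xi> n \<omega>) \<le> K \<and> norm (\<gamma> n \<omega>) \<le> K"
    using bounded_jumps by blast
  have bound: "\<bar>\<xi> (Suc n) \<omega> $ j\<bar> \<le> K" if "\<omega> \<in> space M" for n \<omega>
    using K[rule_format, of "Suc n", OF _ that] component_le_norm_cart[of "\<xi> (Suc n) \<omega>" j] by simp
  have "AE \<omega> in M. (\<lambda>n. (\<Sum>i<n. 1 * \<xi> (Suc i) \<omega> $ j) / real n powr \<alpha>) \<longlonglongrightarrow> 0"
  proof (rule transform_tendsto_0[OF assms, where \<tau> = "\<lambda>n. n" and B = K])
    show "(\<lambda>\<omega>. \<xi> (Suc n) \<omega> $ j) \<in> borel_measurable (info (sources {n<..Suc n}))" for n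
      by (intro borel_measurable_component info_xi) (simp add: sources_def)
  qed (use \<open>K > 0\<close> bound xi_component_mean in \<open>auto simp: incseq_def\<close>)
  then show ?thesis by simp
qed

text \<open>
  The centred count is \<open>o(n)\<close>, and so is its mean since \<open>p\<close> tends to 0.
\<close>
lemma coin_count_small:
  assumes "p \<longlonglongrightarrow> 0"
  shows "AE \<omega> in M. (\<lambda>n. (\<Sum>i<n. coin (Suc i) \<omega>) / real n) \<longlonglongrightarrow> 0"
proof -
  have "AE \<omega> in M. (\<lambda>n. (\<Sum>i<n. 1 * (coin (Suc i) \<omega> - p (Suc i))) / real n powr 1) \<longlonglongrightarrow> 0"
  proof (rule transform_tendsto_0[where \<tau> = "\<lambda>n. n" and B = 2])
    show "(\<lambda>\<omega>. coin (Suc n) \<omega> - p (Suc n)) \<in> borel_measurable (info (sources {n<..Suc n}))" for n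
      by (intro borel_measurable_diff coin_info) (auto simp: sources_def)
    show "expectation (\<lambda>\<omega>. coin (Suc n) \<omega> - p (Suc n)) = 0" for n
      by (subst Bochner_Integration.integral_diff) (auto simp: coin_integrable coin_mean prob_space)
    show "\<bar>coin (Suc n) \<omega> - p (Suc n)\<bar> \<le> 2" for n \<omega>
      using p_range[of "Suc n"] by (auto simp: coin_def)
  qed (auto simp: incseq_def)
  moreover have "(\<lambda>n. (\<Sum>i<n. p (Suc i)) / (\<Sum>i<n. 1 :: real)) \<longlonglongrightarrow> 0"
    using LIMSEQ_Suc[OF assms] filterlim_real_sequentially by (intro stolz_cesaro) auto
  ultimately show ?thesis
  proof (elim AE_mp, intro AE_I2 impI)
    fix \<omega> assume "(\<lambda>n. (\<Sum>i<n. 1 * (coin (Suc i) \<omega> - p (Suc i))) / real n powr 1) \<longlonglongrightarrow> 0"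
      and p: "(\<lambda>n. (\<Sum>i<n. p (Suc i)) / (\<Sum>i<n. 1 :: real)) \<longlonglongrightarrow> 0"
    from tendsto_add[OF this]
    show "(\<lambda>n. (\<Sum>i<n. coin (Suc i) \<omega>) / real n) \<longlonglongrightarrow> 0"
      by (simp add: sum_subtractf diff_divide_distrib)
  qed
qed

text \<open>
  The correction of a fresh step is centred at \<open>p * E \<gamma>\<close>: the coin is independent of the cookie and of the
  step, and the step has mean 0.
\<close>
lemma excitation_fluctuation_small:
  assumes "\<alpha> > 1 / 2"
  shows "AE \<omega> in M. (\<lambda>n. (\<Sum>i<n. fresh i \<omega> * (coin (Suc i) \<omega> * (\<gamma> (Suc i) \<omega> $ j - \<xi> (Suc i) \<omega> $ j)
      - p (Suc i) * expectation (\<gamma> 1) $ j)) / real n powr \<alpha>) \<longlonglongrightarrow> 0"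
proof -
  obtain K where "K > 0" and K: "\<forall>n\<ge>1. \<forall>\<omega>\<in>space M. norm (\<xi> n \<omega>) \<le> K \<and> norm (\<gamma> n \<omega>) \<le> K"
    using bounded_jumps by blast
  define D where "D i \<omega> = \<gamma> i \<omega> $ j - \<xi> i \<omega> $ j" for i \<omega>
  define e where "e = expectation (\<gamma> 1) $ j"
  have D_info: "D i \<in> borel_measurable (info A)" if "Step i \<in> A" "Cookie i \<in> A" for i A
    unfolding D_def using that by (intro borel_measurable_diff borel_measurable_component info_xi info_gamma)
  have D_integrable: "integrable M (D i)" and D_mean: "expectation (D i) = e" if "i \<ge> 1" for i
    unfolding D_def using that xi_component_integrable gamma_component_integrable
    by (auto simp: xi_component_mean gamma_component_mean e_def)
  have prod_integrable: "integrable M (\<lambda>\<omega>. coin i \<omega> * D i \<omega>)"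
    and prod_mean: "expectation (\<lambda>\<omega>. coin i \<omega> * D i \<omega>) = p i * e" if i: "i \<ge> 1" for i
  proof -
    have "indep_var borel (coin i) borel (D i)"
      by (rule indep_info[of "{Coin i}" "{Step i, Cookie i}", OF _ _ _ coin_info D_info])
         (use i in \<open>auto simp: sources_def\<close>)
    note ind = this coin_integrable[OF i] D_integrable[OF i]
    show "integrable M (\<lambda>\<omega>. coin i \<omega> * D i \<omega>)" by (rule indep_var_integrable[OF ind])
    show "expectation (\<lambda>\<omega>. coin i \<omega> * D i \<omega>) = p i * e"
      using indep_var_lebesgue_integral[OF ind] coin_mean[OF i] D_mean[OF i] by simp
  qed
  have bound: "\<bar>coin (Suc n) \<omega> * D (Suc n) \<omega> - p (Suc n) * e\<bar> \<le> 2 * K + \<bar>e\<bar>"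
    if "\<omega> \<in> space M" for n \<omega>
  proof -
    have "\<bar>D (Suc n) \<omega>\<bar> \<le> 2 * K"
    proof -
      have "norm (\<xi> (Suc n) \<omega>) \<le> K" "norm (\<gamma> (Suc n) \<omega>) \<le> K"
        using K that by auto
      then show ?thesis
        using component_le_norm_cart[of "\<xi> (Suc n) \<omega>" j] component_le_norm_cart[of "\<gamma> (Suc n) \<omega>" j]
        unfolding D_def by linarith
    qed
    then have "\<bar>coin (Suc n) \<omega> * D (Suc n) \<omega>\<bar> \<le> 2 * K"
      using \<open>K > 0\<close> by (auto simp: coin_def)
    moreover have "\<bar>p (Suc n) * e\<bar> \<le> \<bar>e\<bar>"
      using p_range[of "Suc n"] mult_right_mono[of "p (Suc n)" 1 "\<bar>e\<bar>"] by (simp add: abs_mult)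
    ultimately show ?thesis by linarith
  qed
  have "AE \<omega> in M. (\<lambda>n. (\<Sum>i<n. fresh i \<omega> * (coin (Suc i) \<omega> * D (Suc i) \<omega> - p (Suc i) * e))
      / real n powr \<alpha>) \<longlonglongrightarrow> 0"
  proof (rule transform_tendsto_0[OF assms, where \<tau> = "\<lambda>n. n" and B = "2 * K + \<bar>e\<bar>"])
    show "(\<lambda>\<omega>. coin (Suc n) \<omega> * D (Suc n) \<omega> - p (Suc n) * e)
        \<in> borel_measurable (info (sources {n<..Suc n}))" for n
      by (intro borel_measurable_diff borel_measurable_times coin_info D_info borel_measurable_const)
         (auto simp: sources_def)
    show "expectation (\<lambda>\<omega>. coin (Suc n) \<omega> * D (Suc n) \<omega> - p (Suc n) * e) = 0" for n
      using prod_integrable[of "Suc n"] prod_mean[of "Suc n"]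
      by (subst Bochner_Integration.integral_diff) (auto simp: prob_space)
    show "0 < 2 * K + \<bar>e\<bar>" using \<open>K > 0\<close> by simp
    show "fresh n \<omega> = 0 \<or> fresh n \<omega> = 1" for n \<omega> by (simp add: fresh_def)
  qed (use bound fresh_info in \<open>auto simp: incseq_def\<close>)
  then show ?thesis by (simp add: D_def e_def)
qed

section \<open>Density of the range\<close>

definition no_return :: "nat \<Rightarrow> nat \<Rightarrow> 'w \<Rightarrow> bool" where
  "no_return m k \<omega> \<longleftrightarrow> (\<forall>j\<in>{1..m}. (\<Sum>i = 1..j. \<xi> (k + i) \<omega>) \<noteq> 0)"

definition esc :: "nat \<Rightarrow> real" where
  "esc m = prob {\<omega> \<in> space M. no_return m 0 \<omega>}"

lemma no_return_info: "Measurable.pred (info (sources {k<..k + m})) (no_return m k)"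
proof -
  have "(\<lambda>\<omega>. \<Sum>i = 1..j. \<xi> (k + i) \<omega>) \<in> borel_measurable (info (sources {k<..k + m}))" if "j \<le> m" for j
    using that by (intro borel_measurable_sum info_xi) (auto simp: sources_def)
  then have "Measurable.pred (info (sources {k<..k + m})) (\<lambda>\<omega>. (\<Sum>i = 1..j. \<xi> (k + i) \<omega>) \<noteq> 0)"
    if "j \<in> {1..m}" for j
    by (rule pred_nonzero) (use that in auto)
  then show ?thesis
    unfolding no_return_def[abs_def] by (intro pred_intros_finite) auto
qed

lemma no_return_events: "{\<omega> \<in> space M. no_return m k \<omega>} \<in> events"
proof -
  have "{\<omega> \<in> space (info (sources {k<..k + m})). no_return m k \<omega>} \<in> sets (info (sources {k<..k + m}))"
    using no_return_info by (simp add: pred_def)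
  then show ?thesis
    using sets_info_events[OF sources_mono[of "{k<..k + m}" "{1..}"]] by force
qed

text \<open>
  Stationarity of the steps, which makes the probability of \<open>no_return m k\<close> independent of \<open>k\<close>.
\<close>
lemma block_distr:
  assumes "m > 0"
  shows "distr M (\<Pi>\<^sub>M i\<in>{1..m}. borel) (\<lambda>\<omega>. \<lambda>i\<in>{1..m}. \<xi> (k + i) \<omega>)
    = (\<Pi>\<^sub>M i\<in>{1..m}. distr M borel (\<xi> 1))"
proof -
  have ind: "indep_vars (\<lambda>_. borel) (\<lambda>i. \<xi> (k + i)) {1..m}"
    unfolding indep_vars_def2
  proof (intro conjI ballI indep_setsI)
    fix A J assume J: "J \<noteq> {}" "J \<subseteq> {1..m}" "finite J"
      and A: "\<forall>i\<in>J. A i \<in> {\<xi> (k + i) -` B \<inter> space M | B. B \<in> sets borel}"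
    have "indep_sets (\<lambda>i. {\<xi> i -` B \<inter> space M | B. B \<in> sets borel}) {1..}"
      using xi_iid by (simp add: iid_def indep_vars_def2)
    from indep_setsD[OF this, of "(+) k ` J" "\<lambda>i. A (i - k)"] J A
    have "prob (\<Inter>i\<in>(+) k ` J. A (i - k)) = (\<Prod>i\<in>(+) k ` J. prob (A (i - k)))"
      by force
    then show "prob (\<Inter>i\<in>J. A i) = (\<Prod>i\<in>J. prob (A i))"
      by (simp add: prod.reindex)
  qed (auto intro!: xi_measurable measurable_sets)
  have "distr M (\<Pi>\<^sub>M i\<in>{1..m}. borel) (\<lambda>\<omega>. \<lambda>i\<in>{1..m}. \<xi> (k + i) \<omega>)
      = (\<Pi>\<^sub>M i\<in>{1..m}. distr M borel (\<xi> (k + i)))"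
    by (subst indep_vars_iff_distr_eq_PiM'[symmetric]) (use assms ind xi_measurable in auto)
  also have "\<dots> = (\<Pi>\<^sub>M i\<in>{1..m}. distr M borel (\<xi> 1))"
  proof (rule PiM_cong[OF refl])
    fix i assume "i \<in> {1..m}"
    then have "1 \<le> k + i" by simp
    then show "distr M borel (\<xi> (k + i)) = distr M borel (\<xi> 1)"
      using xi_iid unfolding iid_def by blast
  qed
  finally show ?thesis .
qed

lemma no_return_prob:
  assumes "m > 0"
  shows "prob {\<omega> \<in> space M. no_return m k \<omega>} = esc m"
proof -
  let ?P = "\<Pi>\<^sub>M i\<in>{1..m}. (borel :: (real ^ 'd) measure)"
  let ?S = "{f \<in> space ?P. \<forall>j\<in>{1..m}. (\<Sum>i = 1..j. f i) \<noteq> 0}"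
  have "(\<lambda>f. \<Sum>i = 1..j. f i) \<in> borel_measurable ?P" if "j \<le> m" for j
    using that by (intro borel_measurable_sum measurable_component_singleton) auto
  then have "Measurable.pred ?P (\<lambda>f. (\<Sum>i = 1..j. f i) \<noteq> 0)" if "j \<in> {1..m}" for j
    by (rule pred_nonzero) (use that in auto)
  then have "Measurable.pred ?P (\<lambda>f. \<forall>j\<in>{1..m}. (\<Sum>i = 1..j. f i) \<noteq> 0)"
    by (intro pred_intros_finite) auto
  then have S: "?S \<in> sets ?P" by (simp add: pred_def)
  have eq: "prob {\<omega> \<in> space M. no_return m k \<omega>} = measure (\<Pi>\<^sub>M i\<in>{1..m}. distr M borel (\<xi> 1)) ?S" for k
  proof -
    have meas: "(\<lambda>\<omega>. \<lambda>i\<in>{1..m}. \<xi> (k + i) \<omega>) \<in> measurable M ?P"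
      by (intro measurable_restrict xi_measurable) auto
    have "{\<omega> \<in> space M. no_return m k \<omega>} = (\<lambda>\<omega>. \<lambda>i\<in>{1..m}. \<xi> (k + i) \<omega>) -` ?S \<inter> space M"
    proof -
      have "(\<Sum>i = 1..j. (\<lambda>i\<in>{1..m}. \<xi> (k + i) \<omega>) i) = (\<Sum>i = 1..j. \<xi> (k + i) \<omega>)" if "j \<in> {1..m}" for j \<omega>
        using that by (intro sum.cong) auto
      then show ?thesis by (auto simp: no_return_def space_PiM)
    qed
    then show ?thesis
      using measure_distr[OF meas S] unfolding block_distr[OF assms] by simp
  qed
  show ?thesis unfolding esc_def eq ..
qed

text \<open>
  The events \<open>no_return m k\<close> overlap for neighbouring \<open>k\<close>, but along a residue class modulo \<open>m\<close> they depend
  on disjoint blocks of steps. So the law of large numbers holds along each of the \<open>m\<close> classes, and averaging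
  over the classes gives the frequency along all \<open>k\<close>.
\<close>
lemma no_return_frequency:
  assumes "m > 0"
  shows "AE \<omega> in M. (\<lambda>N. (\<Sum>k<N * m. of_bool (no_return m k \<omega>)) / real (N * m)) \<longlonglongrightarrow> esc m"
proof -
  define Q where "Q k \<omega> = (of_bool (no_return m k \<omega>) :: real)" for k \<omega>
  have Q_info: "Q k \<in> borel_measurable (info (sources {k<..k + m}))" for k
    unfolding Q_def using no_return_info by measurable
  have Q_mean: "expectation (Q k) = esc m" and Q_integrable: "integrable M (Q k)" for k
  proof -
    have "expectation (Q k) = expectation (indicator {\<omega> \<in> space M. no_return m k \<omega>})"
      by (intro Bochner_Integration.integral_cong) (auto simp: Q_def indicator_def)
    then show "expectation (Q k) = esc m"
      using no_return_events no_return_prob[OF assms] by simp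
    have "Q k \<in> borel_measurable M"
      by (rule info_random_variable[OF Q_info]) (auto intro!: sources_mono)
    then show "integrable M (Q k)"
      by (rule integrable_const_bound[of _ 1, rotated]) (simp add: Q_def)
  qed
  have residue: "AE \<omega> in M. (\<lambda>N. (\<Sum>i<N. 1 * (Q (r + i * m) \<omega> - esc m)) / real N powr 1) \<longlonglongrightarrow> 0" for r
  proof (rule transform_tendsto_0[where \<tau> = "\<lambda>i. r + i * m" and B = 2])
    show "(\<lambda>\<omega>. Q (r + i * m) \<omega> - esc m) \<in> borel_measurable (info (sources {r + i * m<..r + Suc i * m}))" for i
      using Q_info[of "r + i * m"] by (intro borel_measurable_diff) (simp_all add: algebra_simps)
    show "expectation (\<lambda>\<omega>. Q (r + i * m) \<omega> - esc m) = 0" for i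
      using Q_mean Q_integrable by (subst Bochner_Integration.integral_diff) (auto simp: prob_space)
    show "\<bar>Q (r + i * m) \<omega> - esc m\<bar> \<le> 2" for i \<omega>
      using measure_nonneg[of M] prob_le_1 unfolding esc_def Q_def by (smt (verit) of_bool_eq)
  qed (auto simp: incseq_def)
  have "AE \<omega> in M. \<forall>r. (\<lambda>N. (\<Sum>i<N. 1 * (Q (r + i * m) \<omega> - esc m)) / real N powr 1) \<longlonglongrightarrow> 0"
    using residue by (simp add: AE_all_countable)
  then have "AE \<omega> in M. (\<lambda>N. (\<Sum>k<N * m. Q k \<omega>) / real (N * m)) \<longlonglongrightarrow> esc m"
  proof eventually_elim
    case (elim \<omega>)
    have "(\<lambda>N. \<Sum>r<m. (\<Sum>i<N. 1 * (Q (r + i * m) \<omega> - esc m)) / real N powr 1) \<longlonglongrightarrow> (\<Sum>r<m. 0)"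
      by (intro tendsto_sum elim[rule_format])
    then have "(\<lambda>N. (\<Sum>r<m. (\<Sum>i<N. 1 * (Q (r + i * m) \<omega> - esc m)) / real N powr 1) / m + esc m) \<longlonglongrightarrow> 0 / m + esc m"
      using assms by (intro tendsto_intros) auto
    moreover have "eventually (\<lambda>N. (\<Sum>r<m. (\<Sum>i<N. 1 * (Q (r + i * m) \<omega> - esc m)) / real N powr 1) / m + esc m
        = (\<Sum>k<N * m. Q k \<omega>) / real (N * m)) sequentially"
      using eventually_gt_at_top[of 0]
    proof eventually_elim
      case (elim N)
      have "(\<Sum>k<N * m. Q k \<omega>) = (\<Sum>i<N. \<Sum>k\<in>{i * m..<i * m + m}. Q k \<omega>)"
        by (rule sum.nat_group[symmetric])
      also have "\<dots> = (\<Sum>i<N. \<Sum>r<m. Q (r + i * m) \<omega>)"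
      proof (rule sum.cong[OF refl])
        fix i show "(\<Sum>k\<in>{i * m..<i * m + m}. Q k \<omega>) = (\<Sum>r<m. Q (r + i * m) \<omega>)"
          using sum.shift_bounds_nat_ivl[of "\<lambda>k. Q k \<omega>" 0 "i * m" m]
          by (simp add: atLeast0LessThan add.commute)
      qed
      also have "\<dots> = (\<Sum>r<m. \<Sum>i<N. Q (r + i * m) \<omega>)"
        by (rule sum.swap)
      finally have "(\<Sum>k<N * m. Q k \<omega>) = (\<Sum>r<m. \<Sum>i<N. Q (r + i * m) \<omega>)" .
      then show ?case using elim assms
        by (simp add: sum_subtractf sum_divide_distrib[symmetric] field_simps)
    qed
    ultimately show ?case by (simp add: Lim_transform_eventually)
  qed
  then show ?thesis by (simp add: Q_def)
qed

text \<open>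
  The range is counted by last visits. A last visit is less than \<open>m\<close> steps before the end, or is followed
  within \<open>m\<close> steps by a coin showing heads, or the next \<open>m\<close> increments are plain steps of \<open>\<xi>\<close>. In the third
  case, since the walk does not come back, neither do these steps. Every coin is charged with at most \<open>m\<close>
  times.
\<close>
lemma card_range_le:
  assumes w: "\<omega> \<in> space M"
  shows "real (card (walk_range X n \<omega>)) \<le>
    real m + (\<Sum>k\<le>n. of_bool (no_return m k \<omega>)) + real m * (\<Sum>i<n. coin (Suc i) \<omega>)"
proof -
  \<comment> \<open>\<open>L\<close> consists of the last visits up to time \<open>n\<close>, \<open>E\<close> of the times followed by heads\<close>
  define L where "L = {k. k \<le> n \<and> (\<forall>j. k < j \<and> j \<le> n \<longrightarrow> X j \<omega> \<noteq> X k \<omega>)}"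
  define E where "E = {i. i < n \<and> U (Suc i) \<omega> \<le> p (Suc i)}"
  have "walk_range X n \<omega> \<subseteq> (\<lambda>k. X k \<omega>) ` L"
  proof
    fix x assume "x \<in> walk_range X n \<omega>"
    then have ne: "{k. k \<le> n \<and> X k \<omega> = x} \<noteq> {}" by (auto simp: walk_range_def)
    define k where "k = Max {k. k \<le> n \<and> X k \<omega> = x}"
    have "k \<in> {k. k \<le> n \<and> X k \<omega> = x}" unfolding k_def by (rule Max_in[OF _ ne]) simp
    moreover have "j \<le> k" if "j \<le> n" "X j \<omega> = x" for j
      unfolding k_def using that by (intro Max_ge) auto
    ultimately have "k \<in> L" "x = X k \<omega>" by (auto simp: L_def not_le[symmetric])
    then show "x \<in> (\<lambda>k. X k \<omega>) ` L" by blast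
  qed
  moreover have finL: "finite L" by (rule finite_subset[of _ "{..n}"]) (auto simp: L_def)
  ultimately have "card (walk_range X n \<omega>) \<le> card L"
    by (meson card_image_le card_mono finite_imageI order_trans)
  also have "L \<subseteq> {Suc n - m..n} \<union> {k. k \<le> n \<and> no_return m k \<omega>} \<union> (\<Union>i\<in>E. {Suc i - m..i})"
  proof
    fix k assume k: "k \<in> L"
    show "k \<in> {Suc n - m..n} \<union> {k. k \<le> n \<and> no_return m k \<omega>} \<union> (\<Union>i\<in>E. {Suc i - m..i})"
    proof (cases "k + m \<le> n \<and> (\<forall>i\<in>{k..<k + m}. i \<notin> E)")
      case True
      have "X (k + j) \<omega> = X k \<omega> + (\<Sum>i = 1..j. \<xi> (k + i) \<omega>)" if "j \<le> m" for j
        using that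
      proof (induction j)
        case (Suc j)
        then have "k + j \<notin> E" "k + j < n" using True by auto
        then have "\<not> U (Suc (k + j)) \<omega> \<le> p (Suc (k + j))" by (simp add: E_def)
        then show ?case using Suc X_Suc[OF w, of "k + j"] by simp
      qed simp
      moreover have "X (k + j) \<omega> \<noteq> X k \<omega>" if "j \<in> {1..m}" for j
        using k that True by (auto simp: L_def)
      ultimately have "no_return m k \<omega>" unfolding no_return_def by force
      then show ?thesis using k by (simp add: L_def)
    next
      case False
      then show ?thesis using k by (auto simp: L_def E_def)
    qed
  qed
  then have "card L \<le> card ({Suc n - m..n} \<union> {k. k \<le> n \<and> no_return m k \<omega>} \<union> (\<Union>i\<in>E. {Suc i - m..i}))"
    by (intro card_mono) (auto simp: E_def)
  also have "\<dots> \<le> card {Suc n - m..n} + card {k. k \<le> n \<and> no_return m k \<omega>} + card (\<Union>i\<in>E. {Suc i - m..i})"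
    using card_Un_le[of "{Suc n - m..n} \<union> {k. k \<le> n \<and> no_return m k \<omega>}" "\<Union>i\<in>E. {Suc i - m..i}"]
      card_Un_le[of "{Suc n - m..n}" "{k. k \<le> n \<and> no_return m k \<omega>}"] by linarith
  also have "card (\<Union>i\<in>E. {Suc i - m..i}) \<le> (\<Sum>i\<in>E. card {Suc i - m..i})"
    by (rule card_UN_le) (simp add: E_def)
  also have "(\<Sum>i\<in>E. card {Suc i - m..i}) \<le> (\<Sum>i\<in>E. m)"
    by (intro sum_mono) auto
  also have "card {Suc n - m..n} \<le> m" by simp
  finally have "card (walk_range X n \<omega>) \<le> m + card {k. k \<le> n \<and> no_return m k \<omega>} + m * card E"
    by (simp add: mult.commute)
  then have "real (card (walk_range X n \<omega>)) \<le> real m + real (card {k. k \<le> n \<and> no_return m k \<omega>}) + real m * real (card E)"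
    unfolding of_nat_mult[symmetric] of_nat_add[symmetric] of_nat_le_iff .
  moreover have "real (card {k. k \<le> n \<and> no_return m k \<omega>}) = (\<Sum>k\<le>n. of_bool (no_return m k \<omega>))"
    by (simp add: sum_of_bool_eq atMost_def Int_def conj_commute)
  moreover have "real (card E) = (\<Sum>i<n. coin (Suc i) \<omega>)"
    by (simp add: coin_def E_def sum_of_bool_eq lessThan_def Int_def conj_commute)
  ultimately show ?thesis by simp
qed

lemma range_density_upper:
  assumes "p \<longlonglongrightarrow> 0" and m: "m > 0"
  shows "AE \<omega> in M. \<forall>c > esc m. eventually (\<lambda>n. card (walk_range X n \<omega>) / real n < c) sequentially"
proof -
  define f where "f N \<omega> = (\<Sum>k<N * m. of_bool (no_return m k \<omega>)) / real (N * m)" for N \<omega>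
  have "AE \<omega> in M. (\<lambda>N. f N \<omega>) \<longlonglongrightarrow> esc m"
    unfolding f_def by (rule no_return_frequency[OF m])
  then show ?thesis
    using coin_count_small[OF assms(1)] AE_space
  proof eventually_elim
    case (elim \<omega>)
    \<comment> \<open>\<open>no_return_frequency\<close> averages over multiples of \<open>m\<close>, so \<open>n\<close> is rounded up to one\<close>
    have "filterlim (\<lambda>n. Suc (n div m)) at_top sequentially"
      using filterlim_compose[OF filterlim_Suc filterlim_at_top_div_const_nat[OF m]] .
    from filterlim_compose[OF elim(1) this]
    have f_lim: "(\<lambda>n. f (Suc (n div m)) \<omega>) \<longlonglongrightarrow> esc m" .
    have ratio: "(\<lambda>n. real (n + m) / real n) \<longlonglongrightarrow> 1" "(\<lambda>n. real m / real n) \<longlonglongrightarrow> 0"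
      by real_asymp+
    have "(\<lambda>n. real m / real n + f (Suc (n div m)) \<omega> * (real (n + m) / real n)
        + real m * ((\<Sum>i<n. coin (Suc i) \<omega>) / real n)) \<longlonglongrightarrow> 0 + esc m * 1 + real m * 0"
      by (intro tendsto_intros f_lim ratio elim(2))
    then have lim: "(\<lambda>n. real m / real n + f (Suc (n div m)) \<omega> * (real (n + m) / real n)
        + real m * ((\<Sum>i<n. coin (Suc i) \<omega>) / real n)) \<longlonglongrightarrow> esc m"
      by simp
    have bound: "card (walk_range X n \<omega>) / real n \<le> real m / real n
        + f (Suc (n div m)) \<omega> * (real (n + m) / real n)
        + real m * ((\<Sum>i<n. coin (Suc i) \<omega>) / real n)" if "n > 0" for n
    proof -
      define N where "N = Suc (n div m)"
      have N: "n < N * m" "N * m \<le> n + m"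
        using m by (auto simp: N_def) (metis dividend_less_times_div mult.commute mult_Suc_right add.commute)
      have "(\<Sum>k\<le>n. of_bool (no_return m k \<omega>) :: real) \<le> (\<Sum>k<N * m. of_bool (no_return m k \<omega>))"
        using N by (intro sum_mono2) auto
      also have "\<dots> = f N \<omega> * real (N * m)"
      proof -
        have "real (N * m) \<noteq> 0" using N(1) by linarith
        then show ?thesis unfolding f_def by (rule nonzero_eq_divide_eq[THEN iffD1, OF _ refl, symmetric])
      qed
      also have "\<dots> \<le> f N \<omega> * real (n + m)"
        using N(2) by (intro mult_left_mono) (auto simp: f_def sum_nonneg simp del: of_nat_mult of_nat_add)
      finally have "real (card (walk_range X n \<omega>)) \<le> real m + f N \<omega> * real (n + m)
          + real m * (\<Sum>i<n. coin (Suc i) \<omega>)"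
        using card_range_le[OF elim(3), of n m] by linarith
      then have "card (walk_range X n \<omega>) / real n \<le> (real m + f N \<omega> * real (n + m)
          + real m * (\<Sum>i<n. coin (Suc i) \<omega>)) / real n"
        by (intro divide_right_mono) auto
      then show ?thesis by (simp only: N_def add_divide_distrib times_divide_eq_right)
    qed
    show ?case
    proof (intro allI impI)
      fix c assume "c > esc m"
      from order_tendstoD(2)[OF lim this] eventually_gt_at_top[of 0]
      show "eventually (\<lambda>n. card (walk_range X n \<omega>) / real n < c) sequentially"
      proof eventually_elim
        case (elim n)
        then show ?case using bound[of n] by linarith
      qed
    qed
  qed
qed

text \<open>
  Never returning is the decreasing limit of not returning within \<open>m\<close> steps.
\<close>
lemma esc_tendsto: "esc \<longlonglongrightarrow> escape_prob M \<xi>"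
proof -
  define A where "A m = {\<omega> \<in> space M. no_return m 0 \<omega>}" for m
  have "(\<lambda>m. prob (A m)) \<longlonglongrightarrow> prob (\<Inter>m. A m)"
  proof (rule finite_Lim_measure_decseq)
    show "range A \<subseteq> events" using no_return_events by (auto simp: A_def)
    show "decseq A" by (auto simp: decseq_def A_def no_return_def)
  qed
  moreover have "(\<Inter>m. A m) = {\<omega> \<in> space M. \<forall>n\<ge>1. random_walk \<xi> n \<omega> \<noteq> 0}"
  proof -
    have "(\<forall>m. no_return m 0 \<omega>) \<longleftrightarrow> (\<forall>n\<ge>1. random_walk \<xi> n \<omega> \<noteq> 0)" for \<omega>
      by (force simp: no_return_def random_walk_def)
    then show ?thesis by (auto simp: A_def)
  qed
  ultimately show ?thesis by (simp add: escape_prob_def esc_def[abs_def] A_def)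
qed

lemma range_density:
  assumes p: "p \<longlonglongrightarrow> 0"
    and liminf: "AE \<omega> in M. liminf (\<lambda>n. ereal (real (card (walk_range X n \<omega>)) / real n))
      \<ge> ereal (escape_prob M \<xi>)"
  shows "AE \<omega> in M. (\<lambda>n. real (card (walk_range X n \<omega>)) / real n) \<longlonglongrightarrow> escape_prob M \<xi>"
proof -
  have "AE \<omega> in M. \<forall>m. \<forall>c > esc (Suc m). eventually (\<lambda>n. card (walk_range X n \<omega>) / real n < c) sequentially"
    unfolding AE_all_countable using range_density_upper[OF p] by simp
  with liminf show ?thesis
  proof eventually_elim
    case (elim \<omega>)
    show ?case
    proof (rule order_tendstoI)
      fix a assume "a < escape_prob M \<xi>"
      then have "ereal a < liminf (\<lambda>n. ereal (real (card (walk_range X n \<omega>)) / real n))"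
        using elim(1) by (meson ereal_less_eq(3) less_ereal.simps(1) less_le_trans)
      from less_LiminfD[OF this]
      show "eventually (\<lambda>n. a < real (card (walk_range X n \<omega>)) / real n) sequentially" by simp
    next
      fix c assume "escape_prob M \<xi> < c"
      from order_tendstoD(2)[OF LIMSEQ_Suc[OF esc_tendsto] this]
      obtain m where "esc (Suc m) < c" by (auto simp: eventually_sequentially)
      then show "eventually (\<lambda>n. real (card (walk_range X n \<omega>)) / real n < c) sequentially"
        using elim(2) by blast
    qed
  qed
qed

text \<open>
  A site is counted at its first visit.
\<close>
lemma card_range_eq: "real (card (walk_range X n \<omega>)) = (\<Sum>i<Suc n. fresh i \<omega>)"
proof (induction n)
  case 0
  show ?case by (simp add: walk_range_def fresh_def revisits_def)
next
  case (Suc n)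
  have "walk_range X (Suc n) \<omega> = insert (X (Suc n) \<omega>) (walk_range X n \<omega>)"
    by (auto simp: walk_range_def atLeast0_atMost_Suc)
  moreover have "X (Suc n) \<omega> \<in> walk_range X n \<omega> \<longleftrightarrow> revisits X (Suc n) \<omega>"
    unfolding walk_range_def revisits_def image_iff Bex_def
    by (metis atLeastAtMost_iff less_Suc_eq_le zero_le)
  moreover have "finite (walk_range X n \<omega>)" by (simp add: walk_range_def)
  ultimately show ?case using Suc by (simp add: fresh_def card_insert_if)
qed

lemma fresh_density:
  assumes "(\<lambda>n. real (card (walk_range X n \<omega>)) / real n) \<longlonglongrightarrow> c"
  shows "(\<lambda>n. (\<Sum>i<n. fresh i \<omega>) / real n) \<longlonglongrightarrow> c"
proof (rule LIMSEQ_imp_Suc)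
  have "(\<lambda>n. real n / real (Suc n)) \<longlonglongrightarrow> 1" by real_asymp
  from tendsto_mult[OF assms this]
  have "(\<lambda>n. real (card (walk_range X n \<omega>)) / real n * (real n / real (Suc n))) \<longlonglongrightarrow> c" by simp
  then show "(\<lambda>n. (\<Sum>i<Suc n. fresh i \<omega>) / real (Suc n)) \<longlonglongrightarrow> c"
    unfolding card_range_eq[symmetric]
  proof (rule Lim_transform_eventually)
    show "eventually (\<lambda>n. card (walk_range X n \<omega>) / real n * (real n / real (Suc n))
        = card (walk_range X n \<omega>) / real (Suc n)) sequentially"
      using eventually_gt_at_top[of 0] by eventually_elim simp
  qed
qed

section \<open>The limit theorem\<close>

text \<open>
  Subtracting from each cookie correction its mean \<open>p * E \<gamma>\<close> splits off the drift and leaves only centred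
  summands in the first two sums.
\<close>
lemma X_decomposition:
  assumes "\<omega> \<in> space M"
  shows "X n \<omega> $ j = (\<Sum>i<n. \<xi> (Suc i) \<omega> $ j)
    + (\<Sum>i<n. fresh i \<omega> * (coin (Suc i) \<omega> * (\<gamma> (Suc i) \<omega> $ j - \<xi> (Suc i) \<omega> $ j)
        - p (Suc i) * expectation (\<gamma> 1) $ j))
    + expectation (\<gamma> 1) $ j * (\<Sum>i<n. fresh i \<omega> * p (Suc i))"
proof (induction n)
  case 0
  show ?case using X_zero[OF assms] by simp
next
  case (Suc n)
  have "X (Suc n) \<omega> $ j = X n \<omega> $ j + \<xi> (Suc n) \<omega> $ j
      + fresh n \<omega> * coin (Suc n) \<omega> * (\<gamma> (Suc n) \<omega> $ j - \<xi> (Suc n) \<omega> $ j)"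
    by (subst X_Suc[OF assms]) (simp add: fresh_def coin_def)
  then show ?case by (simp add: Suc algebra_simps)
qed

end

theorem theorem2p2:
  fixes M :: "'w measure" and F :: "nat \<Rightarrow> 'w measure"
    and \<xi> \<gamma> X :: "nat \<Rightarrow> 'w \<Rightarrow> real ^ 'd::finite"
    and U :: "nat \<Rightarrow> 'w \<Rightarrow> real"
    and l :: "real ^ 'd"
    and C \<beta> :: real
  assumes "CARD('d) \<ge> 2"
    and "C > 0"
    and "0 < \<beta>" and "\<beta> < 1 / 2"
    and "excited_random_walk M F \<xi> \<gamma> U (\<lambda>n. min (C * real n powr (- \<beta>)) 1) l X"
    and "AE \<omega> in M. liminf (\<lambda>n. ereal (real (card (walk_range X n \<omega>)) / real n))
                      \<ge> ereal (escape_prob M \<xi>)"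
  shows "AE \<omega> in M. (\<lambda>n. X n \<omega> /\<^sub>R (real n powr (1 - \<beta>)))
           \<longlonglongrightarrow> (C * escape_prob M \<xi> / (1 - \<beta>)) *\<^sub>R (\<integral>\<omega>'. \<gamma> 1 \<omega>' \<partial>M)"
proof -
  define p where "p n = min (C * real n powr (- \<beta>)) 1" for n :: nat
  interpret excited_random_walk M F \<xi> \<gamma> U p l X
    using assms(5) unfolding p_def[abs_def] .
  define e where "e = expectation (\<gamma> 1)"
  have \<alpha>: "1 - \<beta> > 1 / 2" using assms(4) by simp
  have p_lim: "p \<longlonglongrightarrow> 0"
  proof (rule tendsto_sandwich[OF _ _ tendsto_const])
    show "(\<lambda>n. C * real n powr (- \<beta>)) \<longlonglongrightarrow> 0" using assms by real_asymp
  qed (use assms in \<open>auto simp: p_def\<close>)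
  have p_decseq: "decseq (\<lambda>i. p (Suc i))"
    unfolding decseq_def p_def
  proof (intro allI impI min.mono order_refl)
    fix m n :: nat assume "m \<le> n"
    then show "C * real (Suc n) powr (- \<beta>) \<le> C * real (Suc m) powr (- \<beta>)"
      using assms(2,3) by (intro mult_left_mono powr_mono2') auto
  qed
  have p_sum: "(\<lambda>n. (\<Sum>i<n. p (Suc i)) / real n powr (1 - \<beta>)) \<longlonglongrightarrow> C / (1 - \<beta>)"
    unfolding p_def using assms by (intro sum_cut_powr_asymp) auto
  have norming: "filterlim (\<lambda>n. real n powr (1 - \<beta>)) at_top sequentially"
    using assms by real_asymp
  have "AE \<omega> in M. \<forall>j. (\<lambda>n. (\<Sum>i<n. \<xi> (Suc i) \<omega> $ j) / real n powr (1 - \<beta>)) \<longlonglongrightarrow> 0"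
    "AE \<omega> in M. \<forall>j. (\<lambda>n. (\<Sum>i<n. fresh i \<omega> * (coin (Suc i) \<omega> * (\<gamma> (Suc i) \<omega> $ j - \<xi> (Suc i) \<omega> $ j)
      - p (Suc i) * e $ j)) / real n powr (1 - \<beta>)) \<longlonglongrightarrow> 0"
    using step_sum_small[OF \<alpha>] excitation_fluctuation_small[OF \<alpha>]
    by (auto simp: e_def intro!: eventually_all_finite)
  with range_density[OF p_lim assms(6)] AE_space show ?thesis
  proof eventually_elim
    case (elim \<omega>)
    have drift: "(\<lambda>n. (\<Sum>i<n. fresh i \<omega> * p (Suc i)) / real n powr (1 - \<beta>)) \<longlonglongrightarrow>
        escape_prob M \<xi> * (C / (1 - \<beta>))"
      by (rule weighted_sum_asymp[OF fresh_density[OF elim(1)] p_decseq _ p_sum norming])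
         (use assms in \<open>simp add: p_def\<close>)
    show ?case
    proof (rule vec_tendstoI)
      fix j
      have "(\<lambda>n. (\<Sum>i<n. \<xi> (Suc i) \<omega> $ j) / real n powr (1 - \<beta>)
          + (\<Sum>i<n. fresh i \<omega> * (coin (Suc i) \<omega> * (\<gamma> (Suc i) \<omega> $ j - \<xi> (Suc i) \<omega> $ j)
              - p (Suc i) * e $ j)) / real n powr (1 - \<beta>)
          + e $ j * ((\<Sum>i<n. fresh i \<omega> * p (Suc i)) / real n powr (1 - \<beta>)))
          \<longlonglongrightarrow> 0 + 0 + e $ j * (escape_prob M \<xi> * (C / (1 - \<beta>)))"
        by (intro tendsto_add tendsto_mult tendsto_const drift elim(3,4)[rule_format])
      then show "(\<lambda>n. (X n \<omega> /\<^sub>R real n powr (1 - \<beta>)) $ j) \<longlonglongrightarrow>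
          ((C * escape_prob M \<xi> / (1 - \<beta>)) *\<^sub>R (\<integral>\<omega>'. \<gamma> 1 \<omega>' \<partial>M)) $ j"
        by (simp add: X_decomposition[OF elim(2)] e_def add_divide_distrib divide_inverse algebra_simps)
    qed
  qed
qed

end
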